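(* Let $\zeta_3$ be a primitive cube root of unity. Then \[ \frac{(-q;q)_\infty}{(q;q)_\infty}\Bigl(\frac12+\sum_{n=1}^\infty\frac{(1-\zeta_3)(1-\zeta_3^{-1})(-1)^nq^n}{(1-\zeta_3q^n)(1-\zeta_3^{-1}q^n)}\Bigr)=A_0(q^3)+qA_1(q^3)+q^2A_2(q^3), \] where \[ A_0(q)=\frac{(q^3;q^3)_\infty^4(q^2;q^2)_\infty}{2(q;q)_\infty^2(q^6;q^6)_\infty^2},\quad A_1(q)=-2\frac{(q^6;q^6)_\infty(q^3;q^3)_\infty}{(q;q)_\infty},\quad A_2(q)=2\frac{(q^6;q^6)_\infty^4}{(q^3;q^3)_\infty^2(q^2;q^2)_\infty}. \]
   Context: $(a;q)_\infty=\prod_{k\ge0}(1-aq^k)$; identities are of formal power series in $q$. *)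

theory Defs
  imports "HOL-Computational_Algebra.Formal_Power_Series"
begin

text \<open>Infinite q-Pochhammer symbol (a;q)_oo as a formal power series.
  Intended for a, q with zero constant term (subdegree at least 1); then the
  factor 1 - a q^k is congruent to 1 modulo X^(k+1), so the N-th coefficient of
  the infinite product equals the N-th coefficient of the finite product over k \<le> N.\<close>
definition qpoch_inf :: "'a::comm_ring_1 fps \<Rightarrow> 'a fps \<Rightarrow> 'a fps" where
  "qpoch_inf a q = Abs_fps (\<lambda>N. fps_nth (\<Prod>k\<le>N. 1 - a * q ^ k) N)"

text \<open>Infinite sum of formal power series f 1 + f 2 + ..., intended for f n of
  order at least n, defined coefficientwise.\<close>
definition fps_infsum1 :: "(nat \<Rightarrow> 'a::comm_ring_1 fps) \<Rightarrow> 'a fps" where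
  "fps_infsum1 f = Abs_fps (\<lambda>N. \<Sum>n\<in>{1..N}. fps_nth (f n) N)"

definition A0 :: "complex fps \<Rightarrow> complex fps" where
  "A0 Q = (qpoch_inf (Q^3) (Q^3) ^ 4 * qpoch_inf (Q^2) (Q^2)) /
          (2 * qpoch_inf Q Q ^ 2 * qpoch_inf (Q^6) (Q^6) ^ 2)"

definition A1 :: "complex fps \<Rightarrow> complex fps" where
  "A1 Q = - 2 * (qpoch_inf (Q^6) (Q^6) * qpoch_inf (Q^3) (Q^3)) / qpoch_inf Q Q"

definition A2 :: "complex fps \<Rightarrow> complex fps" where
  "A2 Q = 2 * qpoch_inf (Q^6) (Q^6) ^ 4 /
          (qpoch_inf (Q^3) (Q^3) ^ 2 * qpoch_inf (Q^2) (Q^2))"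

end

theory Submission
  imports Defs "HOL-Computational_Algebra.Formal_Laurent_Series" "HOL-Computational_Algebra.Polynomial"
begin

text \<open>
  Write \<open>E c = (q^c;q^c)\<close> and \<open>\<phi>(-q) = \<Sum> (-1)^n q^(n^2) = E 1 ^ 2 / E 2\<close> (Jacobi triple product).
  The partial fraction expansion in \<open>w = z + 1/z\<close> of
  \<open>\<Prod> (1 + w q^k + q^(2k)) / (1 - w q^k + q^(2k))\<close> over \<open>k \<le> N\<close> tends, as \<open>N \<rightarrow> \<infinity>\<close> and for \<open>w = -1\<close>,
  to an evaluation of the Lambert series as \<open>\<phi>(-q)^3 / (2 \<phi>(-q^3))\<close>. So the left-hand side is
  \<open>\<phi>(-q)^2 / (2 \<phi>(-q^3))\<close>, and sorting the exponents \<open>n^2\<close> by \<open>n mod 3\<close> gives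
  \<open>\<phi>(-q) = \<phi>(-q^9) - 2 q \<Omega>(-q^3)\<close> with \<open>\<Omega>(-q) = \<Sum> (-1)^n q^(3n^2+2n)\<close>, again a product by the
  triple product. Squaring this dissection yields the three terms on the right.
\<close>

section \<open>The finite Jacobi triple product\<close>

text \<open>The classical arguments use bilateral series in z and negative powers of q, which power
  series in q do not offer. Hence each infinite identity is proved between finite products and sums,
  by regrouping factors or by counting roots of a polynomial, and only then passed to the
  coefficientwise limit. The poles w = q^k + q^(-k) still need negative powers, so the expansion is
  done over a field and applied to Laurent series. The variable w is natural because the product is
  invariant under z -> 1/z. A primitive cube root z has w = -1, and (1 - z)(1 - 1/z) = 2 - w = 3 is
  the constant in the Lambert series. The coefficients of the expansion contain products of two
  ratios (-q;q)_n / (q;q)_n, with n = N - k and n = N + k. All these ratios have the same limit,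
  which factors out and leaves the bare Lambert series. The dissection succeeds because phi(-q^3) is
  a series in q^3: dividing by it keeps the residue classes of exponents apart, and the square of
  phi(-q^9) - 2 q Omega(-q^3) has exactly one term for each class mod 3.\<close>

definition qfac :: "'a::comm_ring_1 \<Rightarrow> nat \<Rightarrow> 'a" where
  "qfac Q n = (\<Prod>i<n. 1 - Q ^ Suc i)"

text \<open>The Gaussian binomial coefficient, given by its q-Pascal rule so that it makes sense in
  any commutative ring without division.\<close>

fun gbinom :: "'a::comm_ring_1 \<Rightarrow> nat \<Rightarrow> nat \<Rightarrow> 'a" where
  "gbinom Q n 0 = 1"
| "gbinom Q 0 (Suc k) = 0"
| "gbinom Q (Suc n) (Suc k) = gbinom Q n (Suc k) + Q ^ (n - k) * gbinom Q n k"

lemma qfac_Suc: "qfac Q (Suc n) = qfac Q n * (1 - Q ^ Suc n)"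
  by (simp add: qfac_def)

lemma qfac_0 [simp]: "qfac Q 0 = 1"
  by (simp add: qfac_def)

lemma gbinom_eq_0: "n < k \<Longrightarrow> gbinom Q n k = 0"
  by (induction Q n k rule: gbinom.induct) auto

lemma gbinom_self [simp]: "gbinom Q n n = 1"
  by (induction n) (auto simp: gbinom_eq_0)

text \<open>Division-free form of the quotient formula. Both terms of the q-Pascal rule have the
  same sum of indices, hence the induction on \<open>n + k\<close>; they combine by (1 - Q^n) + Q^n
  (1 - Q^k) = 1 - Q^(n+k).\<close>

lemma gbinom_qfac: "gbinom Q (n + k) k * (qfac Q n * qfac Q k) = qfac Q (n + k)"
proof (induction "n + k" arbitrary: n k)
  case 0
  then show ?case by simp
next
  case (Suc s)
  consider "n = 0" | "k = 0" | n' k' where "n = Suc n'" "k = Suc k'"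
    by (metis not0_implies_Suc)
  then show ?case
  proof cases
    case 3
    have 1: "gbinom Q (n' + k) k * (qfac Q n' * qfac Q k) = qfac Q (n' + k)"
      and 2: "gbinom Q (n + k') k' * (qfac Q n * qfac Q k') = qfac Q (n + k')"
      using Suc.hyps(1) [of n' k] Suc.hyps(1) [of n k'] Suc.hyps(2) 3 by simp_all
    have s: "n' + k = s" "n + k' = s" "n + k = Suc s" "s - k' = n"
      using Suc 3 by auto
    have "gbinom Q (n + k) k * (qfac Q n * qfac Q k)
        = (gbinom Q s k + Q ^ n * gbinom Q s k') * (qfac Q n * qfac Q k)"
      using s 3 by simp
    also have "\<dots> = (1 - Q ^ n) * (gbinom Q s k * (qfac Q n' * qfac Q k))
        + Q ^ n * (1 - Q ^ k) * (gbinom Q s k' * (qfac Q n * qfac Q k'))"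
      by (simp add: 3 qfac_Suc algebra_simps)
    also have "\<dots> = (1 - Q ^ n * Q ^ k) * qfac Q s"
      using 1 2 unfolding s by (simp add: algebra_simps)
    also have "Q ^ n * Q ^ k = Q ^ Suc s"
      using s by (simp flip: power_add)
    finally show ?thesis by (simp add: s qfac_Suc mult.commute)
  qed auto
qed

text \<open>Kept homogeneous in \<open>b\<close> and \<open>y\<close>: taking \<open>b\<close> to be
  a high power of q will replace the negative powers of the usual triple product proof. Multiplying
  by the factor \<open>b + y * Q ^ M\<close> reproduces the q-Pascal rule.\<close>

lemma q_binomial_theorem:
  "(\<Prod>k<M. b + y * Q ^ k) = (\<Sum>i\<le>M. gbinom Q M i * Q ^ (i choose 2) * y ^ i * b ^ (M - i))"
proof (induction M)
  case 0
  then show ?case by (simp add: numeral_2_eq_2)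
next
  case (Suc M)
  let ?t = "\<lambda>M i. gbinom Q M i * Q ^ (i choose 2) * y ^ i * b ^ (M - i)"
  have step: "?t (Suc M) (Suc i) = b * ?t M (Suc i) + y * Q ^ M * ?t M i" if "i \<le> M" for i
  proof (cases "i = M")
    case True
    then show ?thesis by (simp add: gbinom_eq_0 numeral_2_eq_2 power_add algebra_simps)
  next
    case False
    with that obtain d where d: "M = Suc (i + d)"
      by (metis add_Suc_right le_neq_implies_less less_natE)
    have Q: "Q ^ (M - i) * Q ^ (Suc i choose 2) = Q ^ M * Q ^ (i choose 2)"
      unfolding power_add [symmetric] using d by (simp add: numeral_2_eq_2 add_ac)
    have b: "b ^ (M - i) = b * b ^ (M - Suc i)"
      using d by simp
    have "?t (Suc M) (Suc i) = b * ?t M (Suc i)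
        + (Q ^ (M - i) * Q ^ (Suc i choose 2)) * (gbinom Q M i * y ^ i * y * b ^ (M - i))"
      by (simp add: b algebra_simps)
    also have "\<dots> = b * ?t M (Suc i) + y * Q ^ M * ?t M i"
      unfolding Q by (simp add: mult_ac)
    finally show ?thesis .
  qed
  have "(\<Prod>k<Suc M. b + y * Q ^ k) = (\<Sum>i\<le>M. b * ?t M i) + (\<Sum>i\<le>M. y * Q ^ M * ?t M i)"
    by (simp add: Suc sum.distrib algebra_simps sum_distrib_left)
  also have "(\<Sum>i\<le>M. b * ?t M i) = (\<Sum>i\<le>Suc M. b * ?t M i)"
    by (simp add: gbinom_eq_0)
  also have "\<dots> = b * ?t M 0 + (\<Sum>i\<le>M. b * ?t M (Suc i))"
    by (simp only: sum.atMost_Suc_shift)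
  also have "\<dots> + (\<Sum>i\<le>M. y * Q ^ M * ?t M i)
      = b * ?t M 0 + (\<Sum>i\<le>M. ?t (Suc M) (Suc i))"
    unfolding add.assoc sum.distrib [symmetric]
    by (intro arg_cong2 [where f = "(+)"] sum.cong refl) (simp only: step atMost_iff)
  also have "\<dots> = (\<Sum>i\<le>Suc M. ?t (Suc M) i)"
    by (simp only: sum.atMost_Suc_shift) (simp add: numeral_2_eq_2)
  finally show ?case .
qed

lemma sum_atMost_double_center:
  fixes g :: "nat \<Rightarrow> 'a::comm_monoid_add"
  shows "(\<Sum>i\<le>2 * N. g i) = g N + (\<Sum>j=1..N. g (N + j) + g (N - j))"
proof -
  have "{..2 * N} = {..<N} \<union> {N} \<union> {N<..2 * N}" by auto
  then have "(\<Sum>i\<le>2 * N. g i) = sum g ({..<N} \<union> {N} \<union> {N<..2 * N})" by simp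
  also have "\<dots> = (\<Sum>i<N. g i) + g N + sum g {N<..2 * N}"
    by (subst sum.union_disjoint; auto simp: add.commute)+
  also have "sum g {N<..2 * N} = (\<Sum>j=1..N. g (N + j))"
    by (rule sum.reindex_bij_witness [of _ "\<lambda>j. N + j" "\<lambda>i. i - N"]) auto
  also have "(\<Sum>i<N. g i) = (\<Sum>j=1..N. g (N - j))"
    by (rule sum.reindex_bij_witness [of _ "\<lambda>j. N - j" "\<lambda>i. N - i"]) auto
  finally show ?thesis by (simp add: sum.distrib algebra_simps)
qed

text \<open>The q-binomial theorem with 2N factors, re-centred at index N. The lower N factors, read
  backwards, give the exponents m(2k+1) - r and the upper N give m(2k+1) + r;
  \<open>r \<le> m\<close> keeps every subtraction of naturals exact.\<close>

lemma finite_triple_product: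
  fixes q :: "'a::idom"
  assumes q: "q \<noteq> 0" and r: "r \<le> m"
  shows "(\<Prod>k<N. (1 - q ^ (m * (2 * k + 1) - r)) * (1 - q ^ (m * (2 * k + 1) + r)))
    = gbinom (q ^ (2 * m)) (2 * N) N
      + (\<Sum>j=1..N. (-1) ^ j * (gbinom (q ^ (2 * m)) (2 * N) (N + j) * q ^ (m * j\<^sup>2 + r * j)
                              + gbinom (q ^ (2 * m)) (2 * N) (N - j) * q ^ (m * j\<^sup>2 - r * j)))"
    (is "?L = ?R")
proof -
  \<comment> \<open>The factor 1 - q^(r + m(2i + 1 - 2N)) of the usual proof may have a negative
    exponent; multiplying it by \<open>b\<close> turns it into \<open>b + y * Q ^ i\<close>.\<close>
  define Q b y where "Q = q ^ (2 * m)" and "b = q ^ (m * (2 * N - 1))" and "y = - (q ^ r)"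
  \<comment> \<open>The total power of q pulled out of the 2N factors; it comes with the sign (-1)^N
    from the lower half and cancels at the end.\<close>
  define e where "e = m * (3 * N\<^sup>2 - 2 * N) + r * N"
  have ge: "2 * N \<le> 3 * N\<^sup>2"
    by (cases N) (auto simp: power2_eq_square)
  have low: "b + y * Q ^ (N - Suc k)
      = - (q ^ (2 * m * (N - Suc k) + r)) * (1 - q ^ (m * (2 * k + 1) - r))" if "k < N" for k
  proof -
    from that obtain d where d: "N = Suc (k + d)"
      by (metis add_Suc_right less_natE)
    have "m * (2 * N - 1) = 2 * m * d + r + (m * (2 * k + 1) - r)"
      using r by (simp add: d algebra_simps)
    then have "b = q ^ (2 * m * d + r) * q ^ (m * (2 * k + 1) - r)"
      unfolding b_def by (simp flip: power_add)
    moreover have "y * Q ^ d = - (q ^ (2 * m * d + r))"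
      unfolding y_def Q_def by (simp add: power_add mult.commute flip: power_mult)
    moreover have "N - Suc k = d" using d by simp
    ultimately show ?thesis by (simp add: algebra_simps)
  qed
  have high: "b + y * Q ^ (N + k) = q ^ (m * (2 * N - 1)) * (1 - q ^ (m * (2 * k + 1) + r))"
    if "k < N" for k
  proof -
    from that obtain d where d: "N = Suc d"
      by (metis less_natE)
    have "y * Q ^ (N + k) = - (q ^ (m * (2 * N - 1)) * q ^ (m * (2 * k + 1) + r))"
      unfolding y_def Q_def by (simp add: d flip: power_add power_mult) (simp add: algebra_simps)
    then show ?thesis by (simp add: b_def algebra_simps)
  qed
  have "(\<Prod>k<2 * N. b + y * Q ^ k)
      = (\<Prod>k<N. b + y * Q ^ (N - Suc k)) * (\<Prod>k<N. b + y * Q ^ (N + k))"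
  proof -
    have "{..<2 * N} = {..<N} \<union> {N..<2 * N}" by auto
    then have "(\<Prod>k<2 * N. b + y * Q ^ k)
        = (\<Prod>k<N. b + y * Q ^ k) * (\<Prod>k\<in>{N..<2 * N}. b + y * Q ^ k)"
      by (simp add: prod.union_disjoint ivl_disj_int)
    also have "(\<Prod>k\<in>{N..<2 * N}. b + y * Q ^ k) = (\<Prod>k<N. b + y * Q ^ (N + k))"
      by (rule prod.reindex_bij_witness [of _ "\<lambda>j. N + j" "\<lambda>i. i - N"]) auto
    also have "(\<Prod>k<N. b + y * Q ^ k) = (\<Prod>k<N. b + y * Q ^ (N - Suc k))"
      by (simp only: prod.nat_diff_reindex [of "\<lambda>k. b + y * Q ^ k"])
    finally show ?thesis .
  qed
  also have "\<dots> = (\<Prod>k<N. - (q ^ (2 * m * (N - Suc k) + r)) * (1 - q ^ (m * (2 * k + 1) - r)))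
      * (\<Prod>k<N. q ^ (m * (2 * N - 1)) * (1 - q ^ (m * (2 * k + 1) + r)))"
    by (intro arg_cong2 [where f = "(*)"] prod.cong refl) (use low high in auto)
  also have "\<dots> = (\<Prod>k<N. - (q ^ (2 * m * (N - Suc k) + r + m * (2 * N - 1)))) * ?L"
    unfolding prod.distrib [symmetric] by (intro prod.cong refl) (simp add: power_add mult_ac)
  also have "(\<Prod>k<N. - (q ^ (2 * m * (N - Suc k) + r + m * (2 * N - 1)))) = (-1) ^ N * q ^ e"
  proof -
    have "(\<Prod>k<N. - (q ^ (2 * m * (N - Suc k) + r + m * (2 * N - 1))))
        = (-1) ^ N * q ^ (\<Sum>k<N. 2 * m * (N - Suc k) + r + m * (2 * N - 1))"
      by (simp add: power_sum prod_uminus)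
    also have "(\<Sum>k<N. 2 * m * (N - Suc k) + r + m * (2 * N - 1))
        = (\<Sum>k<N. 2 * m * k + r + m * (2 * N - 1))"
      using sum.nat_diff_reindex [of "\<lambda>k. 2 * m * k + r + m * (2 * N - 1)" N] by simp
    also have "\<dots> = e"
    proof -
      have s: "(\<Sum>k<N. 2 * m * k) = m * (N * (N - 1))" for N
      proof (induction N)
        case (Suc N)
        then show ?case by (cases N) (simp_all add: algebra_simps)
      qed simp
      show ?thesis unfolding e_def sum.distrib s
        by (cases N) (simp_all add: algebra_simps power2_eq_square)
    qed
    finally show ?thesis .
  qed
  finally have L: "(\<Prod>k<2 * N. b + y * Q ^ k) = (-1) ^ N * q ^ e * ?L" .

  define t where "t i = gbinom Q (2 * N) i * Q ^ (i choose 2) * y ^ i * b ^ (2 * N - i)" for i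
  have ch: "2 * (i choose 2) + i = i\<^sup>2" for i
    by (induction i) (auto simp: numeral_2_eq_2)
  have t_gen: "t i = (-1) ^ i * gbinom Q (2 * N) i * q ^ f"
    if "2 * m * (i choose 2) + r * i + m * (2 * N - 1) * (2 * N - i) = f" for i f
    unfolding t_def Q_def y_def b_def that [symmetric]
    by (subst power_minus) (simp add: power_add power_mult [symmetric] mult_ac)
  have tp: "t (N + j) = (-1) ^ N * q ^ e * ((-1) ^ j * (gbinom Q (2 * N) (N + j) * q ^ (m * j\<^sup>2 + r * j)))"
    if "j \<le> N" for j
  proof -
    have "2 * m * ((N + j) choose 2) + r * (N + j) + m * (2 * N - 1) * (2 * N - (N + j))
        = e + (m * j\<^sup>2 + r * j)"
    proof -
      from that obtain d where d: "N = j + d" by (metis le_iff_add)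
      have "int (2 * m * ((N + j) choose 2) + r * (N + j) + m * (2 * N - 1) * (2 * N - (N + j)))
          = int (e + (m * j\<^sup>2 + r * j))"
      \<comment> \<open>\<open>2 * N - 1\<close> truncates at \<open>N = 0\<close>, so this case is
        separate; otherwise all subtractions are exact and the exponents are compared as
        integers.\<close>
      proof (cases "N = 0")
        case False
        have c: "int 2 * int m * int ((N + j) choose 2) = int m * ((int N + int j)\<^sup>2 - (int N + int j))"
        proof -
          have "2 * int ((N + j) choose 2) = (int N + int j)\<^sup>2 - (int N + int j)"
            using arg_cong [OF ch [of "N + j"], of int] that by (simp add: of_nat_diff)
          then show ?thesis by (simp add: mult.left_commute)
        qed
        have e: "int e = int m * (3 * (int N)\<^sup>2 - 2 * int N) + int r * int N"
          unfolding e_def using ge by (simp add: of_nat_diff)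
        have i: "int (2 * N - 1) = 2 * int N - 1" "int (2 * N - (N + j)) = int N - int j"
          using that False by (simp_all add: of_nat_diff)
        show ?thesis
          unfolding of_nat_add of_nat_mult c i e by (simp add: algebra_simps power2_eq_square)
      qed (use that in \<open>simp add: e_def\<close>)
      then show ?thesis by linarith
    qed
    from t_gen [OF this] show ?thesis by (simp add: power_add mult_ac)
  qed
  have tm: "t (N - j) = (-1) ^ N * q ^ e * ((-1) ^ j * (gbinom Q (2 * N) (N - j) * q ^ (m * j\<^sup>2 - r * j)))"
    if "j \<le> N" for j
  proof -
    from that obtain d where d: "N = j + d" by (metis le_iff_add)
    have rj: "r * j \<le> m * j\<^sup>2"
      by (intro mult_le_mono r) (simp add: power2_eq_square)
    have "2 * m * ((N - j) choose 2) + r * (N - j) + m * (2 * N - 1) * (2 * N - (N - j))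
        = e + (m * j\<^sup>2 - r * j)"
    proof -
      have "int (2 * m * ((N - j) choose 2) + r * (N - j) + m * (2 * N - 1) * (2 * N - (N - j)))
          = int (e + (m * j\<^sup>2 - r * j))"
      proof (cases "N = 0")
        case False
        have c: "int 2 * int m * int ((N - j) choose 2) = int m * ((int N - int j)\<^sup>2 - (int N - int j))"
        proof -
          have "2 * int ((N - j) choose 2) = (int N - int j)\<^sup>2 - (int N - int j)"
            using arg_cong [OF ch [of "N - j"], of int] that by (simp add: of_nat_diff)
          then show ?thesis by (simp add: mult.left_commute)
        qed
        have e: "int e = int m * (3 * (int N)\<^sup>2 - 2 * int N) + int r * int N"
          unfolding e_def using ge by (simp add: of_nat_diff)
        have i: "int (2 * N - 1) = 2 * int N - 1" "int (2 * N - (N - j)) = int N + int j"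
            "int (N - j) = int N - int j"
            "int (m * j\<^sup>2 - r * j) = int m * (int j)\<^sup>2 - int r * int j"
          using that False rj by (simp_all add: of_nat_diff)
        show ?thesis
          unfolding of_nat_add of_nat_mult c i e by (simp add: algebra_simps power2_eq_square)
      qed (use that in \<open>simp add: e_def\<close>)
      then show ?thesis by linarith
    qed
    from t_gen [OF this] have "t (N - j) = (-1) ^ (N - j) * gbinom Q (2 * N) (N - j) * q ^ (e + (m * j\<^sup>2 - r * j))" .
    also have "(-1) ^ (N - j) = ((-1) ^ N * (-1) ^ j :: 'a)"
      by (simp add: d flip: power_add) (simp add: power_add)
    finally show ?thesis by (simp add: power_add mult_ac)
  qed
  have "(-1) ^ N * q ^ e * ?L = (\<Sum>i\<le>2 * N. t i)"
    unfolding L [symmetric] q_binomial_theorem t_def ..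
  also have "\<dots> = t N + (\<Sum>j=1..N. t (N + j) + t (N - j))"
    by (rule sum_atMost_double_center)
  also have "\<dots> = (-1) ^ N * q ^ e * ?R"
    unfolding distrib_left sum_distrib_left sum.distrib Q_def [symmetric]
    using tp [of 0] by (simp add: tp tm)
  finally show ?thesis
    using q by simp
qed

section \<open>A finite partial fraction expansion\<close>

text \<open>This is (-q;q)_n / (q;q)_n, the finite form of the prefactor in the theorem.\<close>

definition qratio :: "'a::field \<Rightarrow> nat \<Rightarrow> 'a" where
  "qratio q n = (\<Prod>i=1..n. (1 + q ^ i) / (1 - q ^ i))"

lemma prod_shift_up:
  fixes f :: "nat \<Rightarrow> 'a::comm_monoid_mult"
  shows "(\<Prod>j=1..N. f (j + k)) * (\<Prod>i=1..k. f i) = (\<Prod>i=1..N + k. f i)"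
proof -
  have "{1..N + k} = {1..k} \<union> {k + 1..N + k}" by auto
  then have "(\<Prod>i=1..N + k. f i) = (\<Prod>i=1..k. f i) * (\<Prod>i=k + 1..N + k. f i)"
    by (simp add: prod.union_disjoint)
  also have "(\<Prod>i=k + 1..N + k. f i) = (\<Prod>j=1..N. f (j + k))"
    by (rule prod.reindex_bij_witness [of _ "\<lambda>j. j + k" "\<lambda>i. i - k"]) auto
  finally show ?thesis by (simp add: mult.commute)
qed

text \<open>The products over \<open>j \<noteq> k\<close> at the pole \<open>w = q ^ k + q ^ (- k)\<close>; the power of \<open>q\<close>
  coming from the indices below \<open>k\<close> does not depend on the sign \<open>s\<close>, so it cancels in the residue.\<close>
lemma prod_at_pole:
  fixes q :: "'a::field"
  assumes q: "q \<noteq> 0" and k: "k \<in> {1..N}" and s: "s\<^sup>2 = 1"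
  shows "(\<Prod>j\<in>{1..N} - {k}. 1 + s * (q ^ k + inverse (q ^ k)) * q ^ j + q ^ (2 * j))
        * (1 + s * q ^ (2 * k)) * (\<Prod>i=1..k. 1 + s * q ^ i)
      = s ^ (k - 1) * (\<Prod>i=1..<k. inverse (q ^ i)) * (\<Prod>i=1..N + k. 1 + s * q ^ i)
          * (\<Prod>i=1..N - k. 1 + s * q ^ i) * (\<Prod>i=1..<k. 1 + s * q ^ i)"
proof -
  let ?g = "\<Prod>i=1..<k. inverse (q ^ i)"
  define F where "F n = (\<Prod>i=1..n. 1 + s * q ^ i)" for n
  have "(\<Prod>j\<in>{1..N} - {k}. 1 + s * (q ^ k + inverse (q ^ k)) * q ^ j + q ^ (2 * j))
      = (\<Prod>j\<in>{1..N} - {k}. (1 + s * q ^ (j + k)) * (1 + s * (q ^ j / q ^ k)))"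
  proof (rule prod.cong [OF refl])
    fix j
    \<comment> \<open>At the pole each quadratic factor splits as (1 + s q^(j+k)) (1 + s q^(j-k)),
      because s^2 = 1.\<close>
    have "q ^ (2 * j) = s\<^sup>2 * q ^ (j + k) * (q ^ j / q ^ k)"
      using s q by (simp add: power_add mult_2)
    then show "1 + s * (q ^ k + inverse (q ^ k)) * q ^ j + q ^ (2 * j)
        = (1 + s * q ^ (j + k)) * (1 + s * (q ^ j / q ^ k))"
      using q by (simp only:) (simp add: power_add field_simps power2_eq_square)
  qed
  also have "\<dots> = (\<Prod>j\<in>{1..N} - {k}. 1 + s * q ^ (j + k))
      * (\<Prod>j\<in>{1..N} - {k}. 1 + s * (q ^ j / q ^ k))"
    by (rule prod.distrib)
  also have "(\<Prod>j\<in>{1..N} - {k}. 1 + s * (q ^ j / q ^ k))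
      = (\<Prod>j=1..<k. 1 + s * (q ^ j / q ^ k)) * (\<Prod>j=k + 1..N. 1 + s * (q ^ j / q ^ k))"
  proof -
    have eq: "{1..N} - {k} = {1..<k} \<union> {k + 1..N}" using k by auto
    show ?thesis unfolding eq by (rule prod.union_disjoint) auto
  qed
  also have "(\<Prod>j=k + 1..N. 1 + s * (q ^ j / q ^ k)) = F (N - k)"
    unfolding F_def
    by (rule prod.reindex_bij_witness [of _ "\<lambda>i. i + k" "\<lambda>j. j - k"])
       (use q in \<open>auto simp: power_diff\<close>)
  also have "(\<Prod>j=1..<k. 1 + s * (q ^ j / q ^ k))
      = (\<Prod>i=1..<k. s * inverse (q ^ i) * (1 + s * q ^ i))"
  proof (rule prod.reindex_bij_witness [of _ "\<lambda>i. k - i" "\<lambda>j. k - j"])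
    \<comment> \<open>With i = k - j > 0 the exponent is negative, and 1 + s q^(-i) = s q^(-i) (1 +
      s q^i), again by s^2 = 1.\<close>
    fix j assume j: "j \<in> {1..<k}"
    have "s * inverse (q ^ (k - j)) * (1 + s * q ^ (k - j)) = s * inverse (q ^ (k - j)) + s\<^sup>2"
      using q by (simp add: field_simps power2_eq_square)
    also have "\<dots> = 1 + s * (q ^ j / q ^ k)"
      using q j s by (simp add: power_diff)
    finally show "s * inverse (q ^ (k - j)) * (1 + s * q ^ (k - j)) = 1 + s * (q ^ j / q ^ k)" .
  qed auto
  also have "\<dots> = s ^ (k - 1) * ?g * (\<Prod>i=1..<k. 1 + s * q ^ i)"
    by (simp add: prod.distrib)
  finally have prod_eq: "(\<Prod>j\<in>{1..N} - {k}. 1 + s * (q ^ k + inverse (q ^ k)) * q ^ j + q ^ (2 * j))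
    = (\<Prod>j\<in>{1..N} - {k}. 1 + s * q ^ (j + k))
      * (s ^ (k - 1) * ?g * (\<Prod>i=1..<k. 1 + s * q ^ i) * F (N - k))" .
  have "(\<Prod>j\<in>{1..N} - {k}. 1 + s * (q ^ k + inverse (q ^ k)) * q ^ j + q ^ (2 * j))
        * (1 + s * q ^ (2 * k)) * F k
    = ((1 + s * q ^ (k + k)) * (\<Prod>j\<in>{1..N} - {k}. 1 + s * q ^ (j + k))) * F k *
      (s ^ (k - 1) * ?g * F (N - k) * (\<Prod>i=1..<k. 1 + s * q ^ i))"
    unfolding prod_eq unfolding mult_2 by (simp only: mult_ac)
  \<comment> \<open>This factor fills the gap at \<open>j = k\<close>, and \<open>F k\<close> then
    supplies the indices 1 to k, so that a full product up to \<open>N + k\<close> results.\<close>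
  also have "(1 + s * q ^ (k + k)) * (\<Prod>j\<in>{1..N} - {k}. 1 + s * q ^ (j + k))
      = (\<Prod>j=1..N. 1 + s * q ^ (j + k))"
    using prod.remove [OF _ k, of "\<lambda>j. 1 + s * q ^ (j + k)"] by simp
  also have "(\<Prod>j=1..N. 1 + s * q ^ (j + k)) * F k = F (N + k)"
    unfolding F_def by (rule prod_shift_up)
  finally show ?thesis
    by (simp add: F_def mult_ac)
qed

text \<open>The condition that the denominator-free expansion holds at the pole \<open>a\<close>.
  \<open>prod_at_pole\<close> is used with s = 1 for the numerator and s = -1 for the denominator,
  and the common power of q drops out. The factor \<open>2 - a\<close> enters through (2 - a) q^k =
  -(1 - q^k)^2.\<close>

lemma residue_at_pole:
  fixes q :: "'a::field"
  assumes q: "q \<noteq> 0" "\<And>i. i > 0 \<Longrightarrow> q ^ i \<noteq> 1" and k: "k \<in> {1..N}"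
  defines "a \<equiv> q ^ k + inverse (q ^ k)"
  shows "(\<Prod>j=1..N. 1 + a * q ^ j + q ^ (2 * j))
    = 2 * (-1) ^ k * qratio q (N - k) * qratio q (N + k) * (2 - a) * q ^ k
      * (\<Prod>j\<in>{1..N} - {k}. 1 - a * q ^ j + q ^ (2 * j))"
proof -
  define F where "F s n = (\<Prod>i=1..n. 1 + s * q ^ i)" for s n
  define G where "G s = (\<Prod>j\<in>{1..N} - {k}. 1 + s * a * q ^ j + q ^ (2 * j))" for s
  define g where "g = (\<Prod>i=1..<k. inverse (q ^ i))"
  have g: "G s * (1 + s * q ^ (2 * k)) * F s k
      = s ^ (k - 1) * g * F s (N + k) * F s (N - k) * (\<Prod>i=1..<k. 1 + s * q ^ i)"
    if "s\<^sup>2 = 1" for s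
    unfolding F_def G_def a_def g_def by (rule prod_at_pole [OF q(1) k that])
  have k0: "k > 0" using k by simp
  have nz1: "1 - q ^ i \<noteq> 0" if "i > 0" for i
    using q(2) [OF that] by simp
  have nz2: "1 + q ^ i \<noteq> 0" if "i > 0" for i
  proof
    assume "1 + q ^ i = 0"
    then have "q ^ i = -1" by (simp add: eq_neg_iff_add_eq_0 add.commute)
    then have "q ^ (2 * i) = 1" by (simp add: mult.commute power_mult)
    with q(2) [of "2 * i"] that show False by simp
  qed
  have Fnz: "F 1 n \<noteq> 0" "F (-1) n \<noteq> 0" for n
    using nz1 nz2 by (auto simp: F_def)
  have Fk: "F s k = (\<Prod>i=1..<k. 1 + s * q ^ i) * (1 + s * q ^ k)" for s
    using k0 unfolding F_def by (cases k) (simp_all add: atLeastLessThanSuc_atLeastAtMost)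
  have P: "qratio q n = F 1 n / F (-1) n" for n
    by (simp add: qratio_def F_def prod_dividef)
  have c: "(\<Prod>i=1..<k. 1 + q ^ i) \<noteq> 0" "(\<Prod>i=1..<k. 1 - q ^ i) \<noteq> 0"
    using nz1 nz2 by auto
  have G1: "G 1 * (1 + q ^ (2 * k)) * (1 + q ^ k) = g * F 1 (N + k) * F 1 (N - k)"
    using g [of 1] c by (simp add: Fk mult_ac)
  have G2: "G (-1) * (1 - q ^ (2 * k)) * (1 - q ^ k)
      = (-1) ^ (k - 1) * g * F (-1) (N + k) * F (-1) (N - k)"
    using g [of "-1"] c by (simp add: Fk mult_ac)
  have "(\<Prod>j=1..N. 1 + a * q ^ j + q ^ (2 * j)) = (1 + a * q ^ k + q ^ (2 * k)) * G 1"
    unfolding G_def using prod.remove [OF _ k, of "\<lambda>j. 1 + a * q ^ j + q ^ (2 * j)"] by simp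
  also have "1 + a * q ^ k + q ^ (2 * k) = 2 * (1 + q ^ (2 * k))"
    unfolding power_even_eq power2_eq_square a_def using q(1) by (simp add: field_simps)
  also have "2 * (1 + q ^ (2 * k)) * G 1 = 2 * (G 1 * (1 + q ^ (2 * k)) * (1 + q ^ k)) / (1 + q ^ k)"
    using nz2 [OF k0] by simp
  also have "\<dots> = 2 * (g * F 1 (N + k) * F 1 (N - k)) / (1 + q ^ k)"
    by (simp only: G1)
  also have "\<dots> = 2 * (g * F (-1) (N + k) * F (-1) (N - k)) * qratio q (N - k) * qratio q (N + k) / (1 + q ^ k)"
    using Fnz by (simp add: P)
  also have "g * F (-1) (N + k) * F (-1) (N - k) = (-1) ^ (k - 1) * (G (-1) * (1 - q ^ (2 * k)) * (1 - q ^ k))"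
    unfolding G2 by simp
  also have "2 * ((-1) ^ (k - 1) * (G (-1) * (1 - q ^ (2 * k)) * (1 - q ^ k))) * qratio q (N - k) * qratio q (N + k) / (1 + q ^ k)
      = 2 * (-1) ^ k * qratio q (N - k) * qratio q (N + k) * (- ((1 - q ^ k)\<^sup>2)) * G (-1)"
  proof -
    have e: "1 - q ^ (2 * k) = (1 - q ^ k) * (1 + q ^ k)"
      unfolding power_even_eq power2_eq_square by (simp add: algebra_simps)
    have "(-1) ^ k = - ((-1) ^ (k - 1) :: 'a)"
      using k0 by (cases k) auto
    then show ?thesis using nz2 [OF k0]
      by (simp add: e power2_eq_square)
  qed
  also have "- ((1 - q ^ k)\<^sup>2) = (2 - a) * q ^ k"
    using q(1) by (simp add: a_def field_simps power2_eq_square)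
  finally show ?thesis by (simp add: G_def mult_ac)
qed

text \<open>With denominators cleared, both sides are polynomials in w of degree at most N that
  agree at the N poles and at w = 2, hence everywhere. Writing the fractions with numerator
  \<open>2 - w\<close> makes the constant term the value at w = 2.\<close>

lemma finite_partial_fractions:
  fixes q w :: "'a::field"
  assumes q: "q \<noteq> 0" "\<And>i. i > 0 \<Longrightarrow> q ^ i \<noteq> 1"
    and w: "\<And>k. k \<in> {1..N} \<Longrightarrow> 1 - w * q ^ k + q ^ (2 * k) \<noteq> 0"
  shows "(\<Prod>k=1..N. (1 + w * q ^ k + q ^ (2 * k)) / (1 - w * q ^ k + q ^ (2 * k)))
    = (qratio q N)\<^sup>2 + 2 * (\<Sum>k=1..N. (-1) ^ k * qratio q (N - k) * qratio q (N + k)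
        * ((2 - w) * q ^ k / (1 - w * q ^ k + q ^ (2 * k))))"
proof -
  define a where "a k = q ^ k + inverse (q ^ k)" for k
  define C where "C k = 2 * (-1) ^ k * qratio q (N - k) * qratio q (N + k) * q ^ k" for k
  define p where "p = (\<Prod>k=1..N. [:1 + q ^ (2 * k), q ^ k:])
    - smult ((qratio q N)\<^sup>2) (\<Prod>k=1..N. [:1 + q ^ (2 * k), - (q ^ k):])
    - (\<Sum>k=1..N. smult (C k) ([:2, -1:] * (\<Prod>j\<in>{1..N} - {k}. [:1 + q ^ (2 * j), - (q ^ j):])))"
  have poly_p: "poly p x = (\<Prod>k=1..N. 1 + x * q ^ k + q ^ (2 * k))
      - (qratio q N)\<^sup>2 * (\<Prod>k=1..N. 1 - x * q ^ k + q ^ (2 * k))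
      - (\<Sum>k=1..N. C k * ((2 - x) * (\<Prod>j\<in>{1..N} - {k}. 1 - x * q ^ j + q ^ (2 * j))))" for x
    by (simp add: p_def poly_prod poly_sum algebra_simps)
  have deg_prod: "degree (\<Prod>k\<in>A. [:f k, h k:]) \<le> card A" for A :: "nat set" and f h :: "nat \<Rightarrow> 'a"
  proof (cases "finite A")
    case True
    have "degree (\<Prod>k\<in>A. [:f k, h k:]) \<le> (\<Sum>k\<in>A. degree [:f k, h k:])"
      using degree_prod_sum_le [OF True, of "\<lambda>k. [:f k, h k:]"] by (simp add: o_def)
    also have "\<dots> \<le> (\<Sum>k\<in>A. 1)" by (intro sum_mono) simp
    finally show ?thesis by simp
  qed simp
  have nz1: "1 - q ^ i \<noteq> 0" if "i > 0" for i
    using q(2) [OF that] by simp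
  have deg: "degree p \<le> N"
  proof -
    have 1: "degree (\<Prod>k = 1..N. [:1 + q ^ (2 * k), q ^ k:]) \<le> N"
      by (rule order.trans [OF deg_prod]) simp
    have 2: "degree (smult ((qratio q N)\<^sup>2) (\<Prod>k = 1..N. [:1 + q ^ (2 * k), - (q ^ k):])) \<le> N"
      by (rule order.trans [OF degree_smult_le], rule order.trans [OF deg_prod]) simp
    have "degree (smult (C k) ([:2, -1:] * (\<Prod>j\<in>{1..N} - {k}. [:1 + q ^ (2 * j), - (q ^ j):]))) \<le> N"
      if k: "k \<in> {1..N}" for k
    proof -
      have "degree ([:2, -1:] * (\<Prod>j\<in>{1..N} - {k}. [:1 + q ^ (2 * j), - (q ^ j):]))
          \<le> degree [:2, -1 :: 'a:] + degree (\<Prod>j\<in>{1..N} - {k}. [:1 + q ^ (2 * j), - (q ^ j):])"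
        by (rule degree_mult_le)
      also have "\<dots> \<le> 1 + card ({1..N} - {k})"
        by (intro add_mono deg_prod) simp
      also have "\<dots> = N" using k by auto
      finally show ?thesis by (rule order.trans [OF degree_smult_le])
    qed
    then have "degree (\<Sum>k=1..N. smult (C k) ([:2, -1:] * (\<Prod>j\<in>{1..N} - {k}. [:1 + q ^ (2 * j), - (q ^ j):]))) \<le> N"
      by (intro degree_sum_le) auto
    with 1 2 show ?thesis
      unfolding p_def by (intro degree_diff_le)
  qed
  have at_a: "1 - a k * q ^ k + q ^ (2 * k) = 0" for k
    unfolding power_even_eq power2_eq_square a_def using q(1) by (simp add: field_simps)
  have root_a: "poly p (a k) = 0" if k: "k \<in> {1..N}" for k
  proof -
    have z: "(\<Prod>j\<in>{1..N} - {i}. 1 - a k * q ^ j + q ^ (2 * j)) = 0" if "i \<noteq> k" for i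
      using at_a [of k] k that by (intro prod_zero) auto
    have "(\<Sum>i=1..N. C i * ((2 - a k) * (\<Prod>j\<in>{1..N} - {i}. 1 - a k * q ^ j + q ^ (2 * j))))
        = C k * ((2 - a k) * (\<Prod>j\<in>{1..N} - {k}. 1 - a k * q ^ j + q ^ (2 * j)))"
      using z by (subst sum.remove [OF _ k]) (simp_all add: sum.neutral)
    moreover have "(\<Prod>j=1..N. 1 - a k * q ^ j + q ^ (2 * j)) = 0"
      using at_a [of k] k by (intro prod_zero) auto
    ultimately show ?thesis
      unfolding poly_p using residue_at_pole [OF q k] by (simp add: C_def a_def mult_ac)
  qed
  \<comment> \<open>At w = 2 (that is, z = 1) the fractions vanish and each quadratic factor is a
    perfect square, which yields \<open>(qratio q N) ^ 2\<close>.\<close>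
  have root_2: "poly p 2 = 0"
  proof -
    have "1 + 2 * q ^ k + q ^ (2 * k) = ((1 + q ^ k) / (1 - q ^ k))\<^sup>2 * (1 - 2 * q ^ k + q ^ (2 * k))"
      if "k \<in> {1..N}" for k
    proof -
      have 1: "1 + 2 * q ^ k + q ^ (2 * k) = (1 + q ^ k)\<^sup>2" "1 - 2 * q ^ k + q ^ (2 * k) = (1 - q ^ k)\<^sup>2"
        unfolding power_even_eq power2_eq_square by (simp_all add: algebra_simps)
      show ?thesis unfolding 1 using nz1 [of k] that by (simp add: power_divide)
    qed
    then have "(\<Prod>k=1..N. 1 + 2 * q ^ k + q ^ (2 * k))
        = (\<Prod>k=1..N. ((1 + q ^ k) / (1 - q ^ k))\<^sup>2 * (1 - 2 * q ^ k + q ^ (2 * k)))"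
      by (intro prod.cong) auto
    then show ?thesis
      unfolding poly_p by (simp add: prod.distrib qratio_def prod_power_distrib)
  qed
  have inj: "inj_on a {1..N}"
  proof (rule linorder_inj_onI)
    fix i k :: nat assume ik: "i < k"
    show "a i \<noteq> a k"
    proof
      \<comment> \<open>The poles are distinct since x + 1/x = y + 1/y only for x = y or xy = 1, and
        neither can hold as no positive power of q is 1.\<close>
      assume "a i = a k"
      then have "(q ^ k - q ^ i) * (1 - q ^ (i + k)) = 0"
        using q(1) by (simp add: a_def field_simps power_add)
      then have "q ^ k = q ^ i"
        using nz1 [of "i + k"] ik by auto
      then have "q ^ i * (1 - q ^ (k - i)) = 0"
        using ik q(1) by (simp add: algebra_simps flip: power_add)
      then show False using q(1) nz1 [of "k - i"] ik by auto
    qed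
  qed auto
  have a2: "2 \<notin> a ` {1..N}"
  proof
    assume "2 \<in> a ` {1..N}"
    then obtain k where k: "k \<in> {1..N}" "2 = a k" by blast
    then have "(1 - q ^ k)\<^sup>2 = 0"
      using q(1) by (simp add: a_def field_simps power2_eq_square)
    then show False using nz1 [of k] k by simp
  qed
  have "p = 0"
  proof (rule poly_eqI_degree)
    have "card (insert 2 (a ` {1..N})) = Suc N"
      using a2 inj by (simp add: card_image)
    then show "card (insert 2 (a ` {1..N})) > degree p" "card (insert 2 (a ` {1..N})) > degree (0 :: 'a poly)"
      using deg by auto
    show "poly p x = poly 0 x" if "x \<in> insert 2 (a ` {1..N})" for x
      using that root_a root_2 by auto
  qed
  define D where "D = (\<Prod>k=1..N. 1 - w * q ^ k + q ^ (2 * k))"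
  have Dk: "(\<Prod>j\<in>{1..N} - {k}. 1 - w * q ^ j + q ^ (2 * j)) = D / (1 - w * q ^ k + q ^ (2 * k))"
    if "k \<in> {1..N}" for k
    unfolding D_def using prod.remove [OF _ that, of "\<lambda>k. 1 - w * q ^ k + q ^ (2 * k)"] w [OF that] by simp
  have D0: "D \<noteq> 0" unfolding D_def using w by simp
  have "(\<Prod>k=1..N. 1 + w * q ^ k + q ^ (2 * k)) = (qratio q N)\<^sup>2 * D
      + (\<Sum>k=1..N. C k * ((2 - w) * (\<Prod>j\<in>{1..N} - {k}. 1 - w * q ^ j + q ^ (2 * j))))"
    using poly_p [of w] \<open>p = 0\<close> by (simp add: D_def algebra_simps)
  also have "(\<Sum>k=1..N. C k * ((2 - w) * (\<Prod>j\<in>{1..N} - {k}. 1 - w * q ^ j + q ^ (2 * j))))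
      = D * (2 * (\<Sum>k=1..N. (-1) ^ k * qratio q (N - k) * qratio q (N + k)
        * ((2 - w) * q ^ k / (1 - w * q ^ k + q ^ (2 * k)))))"
    unfolding sum_distrib_left by (intro sum.cong refl) (simp only: Dk, simp add: C_def mult_ac)
  finally show ?thesis
    using D0 unfolding prod_dividef D_def [symmetric] by (simp add: field_simps)
qed

section \<open>Limits of formal power series\<close>

lemma tendsto_fps_add:
  fixes F G :: "'a \<Rightarrow> 'b::ab_group_add fps"
  assumes "(F \<longlongrightarrow> f) A" "(G \<longlongrightarrow> g) A"
  shows "((\<lambda>x. F x + G x) \<longlongrightarrow> f + g) A"
  unfolding tendsto_fps_iff
proof
  fix n
  from assms have "eventually (\<lambda>x. fps_nth (F x) n = fps_nth f n) A" "eventually (\<lambda>x. fps_nth (G x) n = fps_nth g n) A"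
    unfolding tendsto_fps_iff by auto
  then show "eventually (\<lambda>x. fps_nth (F x + G x) n = fps_nth (f + g) n) A"
    by eventually_elim simp
qed

lemma tendsto_fps_mult:
  fixes F G :: "'a \<Rightarrow> 'b::comm_ring_1 fps"
  assumes "(F \<longlongrightarrow> f) A" "(G \<longlongrightarrow> g) A"
  shows "((\<lambda>x. F x * G x) \<longlongrightarrow> f * g) A"
  unfolding tendsto_fps_iff
proof
  fix n
  have "eventually (\<lambda>x. \<forall>i\<in>{..n}. fps_nth (F x) i = fps_nth f i) A"
    "eventually (\<lambda>x. \<forall>i\<in>{..n}. fps_nth (G x) i = fps_nth g i) A"
    using assms unfolding tendsto_fps_iff by (auto intro!: eventually_ball_finite)
  then show "eventually (\<lambda>x. fps_nth (F x * G x) n = fps_nth (f * g) n) A"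
    by eventually_elim (simp add: fps_mult_nth)
qed

lemma tendsto_fps_power:
  fixes F :: "'a \<Rightarrow> 'b::comm_ring_1 fps"
  assumes "(F \<longlongrightarrow> f) A"
  shows "((\<lambda>x. F x ^ n) \<longlongrightarrow> f ^ n) A"
  by (induction n) (auto intro: tendsto_fps_mult assms)

text \<open>A formal Tannery theorem: divisibility by \<open>fps_X ^ j\<close> plays the role of the
  dominating bound, since coefficient n then sees only the terms with j at most n.\<close>

lemma tendsto_fps_infsum1:
  fixes f :: "nat \<Rightarrow> nat \<Rightarrow> 'a::comm_ring_1 fps"
  assumes lim: "\<And>j. j > 0 \<Longrightarrow> (\<lambda>N. f N j) \<longlonglongrightarrow> g j"
    and dvd: "\<And>N j. fps_X ^ j dvd f N j"
  shows "(\<lambda>N. \<Sum>j=1..N. f N j) \<longlonglongrightarrow> fps_infsum1 g"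
  unfolding tendsto_fps_iff
proof
  fix n
  have small: "fps_nth (f N j) n = 0" if "n < j" for N j
    using dvd [of j N] that by (auto simp: fps_X_power_mult_nth)
  have "eventually (\<lambda>N. \<forall>j\<in>{1..n}. fps_nth (f N j) n = fps_nth (g j) n) sequentially"
    using lim unfolding tendsto_fps_iff by (auto intro!: eventually_ball_finite)
  moreover have "eventually (\<lambda>N. N \<ge> n) sequentially"
    by (rule eventually_ge_at_top)
  ultimately show "eventually (\<lambda>N. fps_nth (\<Sum>j=1..N. f N j) n = fps_nth (fps_infsum1 g) n) sequentially"
  proof eventually_elim
    case (elim N)
    have "fps_nth (\<Sum>j=1..N. f N j) n = (\<Sum>j=1..N. fps_nth (f N j) n)"
      by (rule fps_sum_nth)
    also have "\<dots> = (\<Sum>j=1..n. fps_nth (f N j) n)"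
      using elim(2) small by (intro sum.mono_neutral_right) auto
    also have "\<dots> = fps_nth (fps_infsum1 g) n"
      using elim(1) by (simp add: fps_infsum1_def)
    finally show ?case .
  qed
qed

text \<open>Connects the diagonal definition of \<open>qpoch_inf\<close> with a genuine limit:
  \<open>a\<close> and \<open>q\<close> are divisible by \<open>fps_X\<close>, so factors of index
  above n do not change coefficient n.\<close>

lemma qpoch_inf_limit:
  fixes a q :: "'a::comm_ring_1 fps"
  assumes "fps_nth a 0 = 0" "fps_nth q 0 = 0"
  shows "(\<lambda>N. \<Prod>k<N. 1 - a * q ^ k) \<longlonglongrightarrow> qpoch_inf a q"
  unfolding tendsto_fps_iff
proof
  fix n
  have ind: "fps_nth (\<Prod>k<Suc n + d. 1 - a * q ^ k) n = fps_nth (\<Prod>k\<le>n. 1 - a * q ^ k) n" for d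
  proof (induction d)
    case (Suc d)
    have z: "fps_nth (F * (a * q ^ (Suc n + d))) n = 0" for F
    proof -
      have X: "f = fps_X * fps_shift 1 f" if "fps_nth f 0 = 0" for f :: "'a fps"
        by (rule fps_ext) (simp add: that)
      obtain a' q' where "a = fps_X * a'" "q = fps_X * q'"
        using X [OF assms(1)] X [OF assms(2)] by blast
      then have "F * (a * q ^ (Suc n + d)) = fps_X ^ Suc n * (F * a' * fps_X ^ Suc d * q' ^ (Suc n + d))"
        by (simp add: power_mult_distrib power_add mult_ac)
      then show ?thesis by (simp only: fps_X_power_mult_nth) simp
    qed
    have "(\<Prod>k<Suc n + Suc d. 1 - a * q ^ k) = (\<Prod>k<Suc n + d. 1 - a * q ^ k)
        - (\<Prod>k<Suc n + d. 1 - a * q ^ k) * (a * q ^ (Suc n + d))"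
      unfolding add_Suc_right prod.lessThan_Suc by (rule trans [OF right_diff_distrib]) simp
    then show ?case using Suc by (simp only: fps_sub_nth z diff_zero)
  qed (simp add: lessThan_Suc_atMost)
  show "eventually (\<lambda>N. fps_nth (\<Prod>k<N. 1 - a * q ^ k) n = fps_nth (qpoch_inf a q) n) sequentially"
    unfolding eventually_sequentially
  proof (intro exI allI impI)
    fix N assume "Suc n \<le> N"
    then obtain d where "N = Suc n + d" by (metis le_iff_add)
    then show "fps_nth (\<Prod>k<N. 1 - a * q ^ k) n = fps_nth (qpoch_inf a q) n"
      by (simp only: ind) (simp add: qpoch_inf_def)
  qed
qed

section \<open>Theta series\<close>

definition euler :: "nat \<Rightarrow> 'a::comm_ring_1 fps" where
  "euler c = qpoch_inf (fps_X ^ c) (fps_X ^ c)"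

lemma qfac_limit:
  assumes "c > 0" "filterlim h at_top F"
  shows "((\<lambda>x. qfac (fps_X ^ c) (h x)) \<longlongrightarrow> (euler c :: 'a::comm_ring_1 fps)) F"
proof -
  have "(\<lambda>N. qfac (fps_X ^ c) N) \<longlonglongrightarrow> (euler c :: 'a fps)"
    using qpoch_inf_limit [of "fps_X ^ c" "fps_X ^ c :: 'a fps"] assms(1)
    by (simp add: euler_def qfac_def)
  then show ?thesis using assms(2) by (rule filterlim_compose)
qed

lemma qfac_nth_0: "c > 0 \<Longrightarrow> fps_nth (qfac (fps_X ^ c) n) 0 = (1 :: 'a::comm_ring_1)"
  by (induction n) (auto simp: qfac_Suc)

lemma euler_nth_0 [simp]: "c > 0 \<Longrightarrow> fps_nth (euler c) 0 = (1 :: 'a::comm_ring_1)"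
  by (simp add: euler_def qpoch_inf_def)

lemma euler_nonzero [simp]: "c > 0 \<Longrightarrow> euler c \<noteq> (0 :: 'a::comm_ring_1 fps)"
  using euler_nth_0 [of c] by (metis fps_zero_nth zero_neq_one)

text \<open>The quotient of q-factorials tends to E / (E E) with E = \<open>euler c\<close>, because
  \<open>h N\<close> and \<open>2 * N - h N\<close> both grow without bound; the extra factor E
  normalises the limit to 1.\<close>

lemma gbinom_limit:
  assumes c: "c > 0" and h: "eventually (\<lambda>N. h N \<le> 2 * N) sequentially"
    "filterlim h at_top sequentially" "filterlim (\<lambda>N. 2 * N - h N) at_top sequentially"
  shows "(\<lambda>N. euler c * gbinom (fps_X ^ c) (2 * N) (h N)) \<longlonglongrightarrow> (1 :: 'a::field fps)"
proof -
  let ?Q = "fps_X ^ c :: 'a fps"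
  have "filterlim (\<lambda>N. 2 * N) at_top sequentially"
    by (rule filterlim_subseq) (simp add: strict_mono_def)
  then have "(\<lambda>N. euler c * qfac ?Q (2 * N) * (inverse (qfac ?Q (2 * N - h N)) * inverse (qfac ?Q (h N))))
      \<longlonglongrightarrow> euler c * euler c * (inverse (euler c) * inverse (euler c))"
    using c h by (intro tendsto_fps_mult tendsto_inverse_fps tendsto_const qfac_limit) auto
  also have "euler c * euler c * (inverse (euler c) * inverse (euler c)) = (1 :: 'a fps)"
    using inverse_mult_eq_1' [of "euler c :: 'a fps"] c by (simp add: mult_ac)
  finally have lim: "(\<lambda>N. euler c * qfac ?Q (2 * N) * (inverse (qfac ?Q (2 * N - h N)) * inverse (qfac ?Q (h N))))
      \<longlonglongrightarrow> 1" .
  have "eventually (\<lambda>N. euler c * qfac ?Q (2 * N) * (inverse (qfac ?Q (2 * N - h N)) * inverse (qfac ?Q (h N)))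
      = euler c * gbinom ?Q (2 * N) (h N)) sequentially"
    using h(1)
  proof eventually_elim
    case (elim N)
    let ?n = "2 * N - h N"
    have i: "qfac ?Q n * inverse (qfac ?Q n) = 1" for n
      using c by (intro inverse_mult_eq_1') (simp add: qfac_nth_0)
    have "qfac ?Q (2 * N) = gbinom ?Q (2 * N) (h N) * (qfac ?Q ?n * qfac ?Q (h N))"
      using gbinom_qfac [of ?Q ?n "h N"] elim by simp
    then have "euler c * qfac ?Q (2 * N) * (inverse (qfac ?Q ?n) * inverse (qfac ?Q (h N)))
        = euler c * gbinom ?Q (2 * N) (h N) * (qfac ?Q ?n * inverse (qfac ?Q ?n)) * (qfac ?Q (h N) * inverse (qfac ?Q (h N)))"
      by (simp only: mult_ac)
    then show ?case by (simp only: i mult_1_right)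
  qed
  from tendsto_cong [OF this] lim show ?thesis by simp
qed

text \<open>The bilateral sum of (-1)^n q^(m n^2 + r n) over all integers n, with n = j and n = -j
  paired and \<open>r \<le> m\<close> intended. The overview's phi(-q) is
  \<open>theta q 1 0\<close>, and Omega(-q) is \<open>theta q 3 2\<close>.\<close>

definition theta :: "'a::comm_ring_1 fps \<Rightarrow> nat \<Rightarrow> nat \<Rightarrow> 'a fps" where
  "theta q m r = 1 + fps_infsum1 (\<lambda>j. (-1) ^ j * (q ^ (m * j\<^sup>2 + r * j) + q ^ (m * j\<^sup>2 - r * j)))"

text \<open>Provides the divisibility that \<open>tendsto_fps_infsum1\<close> asks for: with r < m,
  at least j^2 remains of m j^2 after subtracting r j.\<close>

lemma theta_exponents:
  fixes r m c :: nat
  assumes "r < m" "c > 0"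
  shows "j \<le> c * (m * j\<^sup>2 + r * j)" "j \<le> c * (m * j\<^sup>2 - r * j)"
proof -
  obtain d where d: "m = Suc (r + d)" using assms(1) by (metis add_Suc_right less_natE)
  have "r * j \<le> r * j\<^sup>2" "j \<le> j\<^sup>2" by (simp_all add: power2_eq_square)
  moreover have "m * j\<^sup>2 = j\<^sup>2 + r * j\<^sup>2 + d * j\<^sup>2" by (simp add: d add_mult_distrib)
  ultimately have *: "j \<le> m * j\<^sup>2 - r * j" by linarith
  have "x \<le> c * x" for x using assms(2) by simp
  with * show "j \<le> c * (m * j\<^sup>2 - r * j)" by (meson le_trans)
  have "j \<le> m * j\<^sup>2 + r * j" using * by linarith
  then show "j \<le> c * (m * j\<^sup>2 + r * j)"
    using \<open>\<And>x. x \<le> c * x\<close> by (meson le_trans)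
qed

lemma theta_partial_sums:
  assumes "r < m" "c > 0"
  shows "(\<lambda>N. 1 + (\<Sum>j=1..N. (-1) ^ j * ((fps_X ^ c) ^ (m * j\<^sup>2 + r * j) + (fps_X ^ c) ^ (m * j\<^sup>2 - r * j))))
    \<longlonglongrightarrow> theta (fps_X ^ c :: 'a::comm_ring_1 fps) m r"
  unfolding theta_def power_mult [symmetric]
  using theta_exponents [OF assms]
  by (intro tendsto_fps_add tendsto_const tendsto_fps_infsum1 dvd_mult dvd_add le_imp_power_dvd)

text \<open>Jacobi's triple product. The product side stays a limit of finite products, so that its
  factors can be regrouped into q-factorials before passing to the limit.\<close>

lemma triple_product_limit:
  fixes q :: "'a::field fps"
  assumes r: "r < m" and c: "c > 0"
  defines "q \<equiv> fps_X ^ c"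
  shows "(\<lambda>N. euler (2 * m * c) * (\<Prod>k<N. (1 - q ^ (m * (2 * k + 1) - r)) * (1 - q ^ (m * (2 * k + 1) + r))))
    \<longlonglongrightarrow> theta q m r"
proof -
  define E g where "E = (euler (2 * m * c) :: 'a fps)" and "g = gbinom (fps_X ^ (2 * m * c) :: 'a fps)"
  have mc: "2 * m * c > 0" using r c by simp
  have "E * (\<Prod>k<N. (1 - q ^ (m * (2 * k + 1) - r)) * (1 - q ^ (m * (2 * k + 1) + r)))
      = E * g (2 * N) N + (\<Sum>j=1..N. (-1) ^ j * (E * g (2 * N) (N + j) * q ^ (m * j\<^sup>2 + r * j)
          + E * g (2 * N) (N - j) * q ^ (m * j\<^sup>2 - r * j)))" for N
  proof -
    have Q: "q ^ (2 * m) = fps_X ^ (2 * m * c)"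
      by (simp add: q_def mult.commute flip: power_mult)
    have "q \<noteq> 0" by (simp add: q_def)
    from finite_triple_product [OF this less_imp_le [OF r], of N] show ?thesis
      unfolding Q g_def by (simp add: algebra_simps sum_distrib_left)
  qed
  moreover have "(\<lambda>N. E * g (2 * N) N + (\<Sum>j=1..N. (-1) ^ j * (E * g (2 * N) (N + j) * q ^ (m * j\<^sup>2 + r * j)
          + E * g (2 * N) (N - j) * q ^ (m * j\<^sup>2 - r * j))))
      \<longlonglongrightarrow> 1 + fps_infsum1 (\<lambda>j. (-1) ^ j * (1 * q ^ (m * j\<^sup>2 + r * j) + 1 * q ^ (m * j\<^sup>2 - r * j)))"
  proof (intro tendsto_fps_add tendsto_fps_infsum1 tendsto_fps_mult tendsto_const)
    have sub: "filterlim (\<lambda>N. N - j) at_top sequentially" for j :: nat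
      by (rule filterlim_minus_const_nat_at_top)
    have add: "filterlim (\<lambda>N. N + j) at_top sequentially" for j :: nat
      by (rule filterlim_subseq) (simp add: strict_mono_def)
    have ge: "eventually (\<lambda>N. j \<le> N) sequentially" for j :: nat
      by (rule eventually_ge_at_top)
    show "(\<lambda>N. E * g (2 * N) N) \<longlonglongrightarrow> 1"
      unfolding E_def g_def
      by (rule gbinom_limit [OF mc]) (use add [of 0] in simp_all)
    fix j :: nat
    show "(\<lambda>N. E * g (2 * N) (N + j)) \<longlonglongrightarrow> 1"
      unfolding E_def g_def
    proof (rule gbinom_limit [OF mc])
      show "eventually (\<lambda>N. N + j \<le> 2 * N) sequentially"
        using ge [of j] by eventually_elim simp
      have "2 * N - (N + j) = N - j" for N by simp
      then show "filterlim (\<lambda>N. 2 * N - (N + j)) at_top sequentially"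
        using sub [of j] by (simp only:)
    qed (rule add)
    show "(\<lambda>N. E * g (2 * N) (N - j)) \<longlonglongrightarrow> 1"
      unfolding E_def g_def
    proof (rule gbinom_limit [OF mc])
      show "eventually (\<lambda>N. N - j \<le> 2 * N) sequentially"
        by (intro always_eventually) auto
      show "filterlim (\<lambda>N. 2 * N - (N - j)) at_top sequentially"
        by (rule filterlim_at_top_mono [OF add [of 0]]) (intro always_eventually, auto)
    qed (rule sub)
  next
    fix N j :: nat
    have "fps_X ^ j dvd q ^ (m * j\<^sup>2 + r * j)" "fps_X ^ j dvd q ^ (m * j\<^sup>2 - r * j)"
      unfolding q_def power_mult [symmetric]
      by (rule le_imp_power_dvd, rule theta_exponents [OF r c])+
    then show "fps_X ^ j dvd (-1) ^ j * (E * g (2 * N) (N + j) * q ^ (m * j\<^sup>2 + r * j)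
          + E * g (2 * N) (N - j) * q ^ (m * j\<^sup>2 - r * j))"
      by (intro dvd_mult dvd_add)
  qed
  ultimately show ?thesis
    by (simp add: theta_def flip: E_def)
qed

lemma filterlim_times_at_top: "k > 0 \<Longrightarrow> filterlim (\<lambda>N. k * N) at_top (sequentially)" for k :: nat
  by (rule filterlim_subseq) (simp add: strict_mono_def)

text \<open>The exponents in the triple product are the odd numbers, each twice: (q;q)_2N with its
  even factors (q^2;q^2)_N removed, squared.\<close>

lemma theta_1_0:
  assumes c: "c > 0"
  shows "theta (fps_X ^ c) 1 0 * euler (2 * c) = (euler c :: 'a::field fps)\<^sup>2"
proof -
  define q where "q = (fps_X ^ c :: 'a fps)"
  let ?L = "\<lambda>N. \<Prod>k<N. (1 - q ^ (1 * (2 * k + 1) - 0)) * (1 - q ^ (1 * (2 * k + 1) + 0))"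
  have q2: "fps_X ^ (2 * c) = q ^ 2" by (simp add: q_def mult.commute flip: power_mult)
  have "?L N * (qfac (q\<^sup>2) N)\<^sup>2 = (qfac q (2 * N))\<^sup>2" for N
  proof (induction N)
    case (Suc N)
    have s: "2 * Suc N = Suc (Suc (2 * N))" by simp
    have e: "1 * (2 * N + 1) - 0 = 2 * N + 1" "1 * (2 * N + 1) + 0 = 2 * N + 1"
      "2 * Suc N = 2 * N + 2" "Suc (2 * N) = 2 * N + 1" "Suc (2 * N + 1) = 2 * N + 2"
      by simp_all
    have "?L (Suc N) * (qfac (q\<^sup>2) (Suc N))\<^sup>2
        = (?L N * (qfac (q\<^sup>2) N)\<^sup>2) * ((1 - q ^ (2 * N + 1)) * (1 - q ^ (2 * N + 2)))\<^sup>2"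
      unfolding prod.lessThan_Suc qfac_Suc power_mult [symmetric] e
      by (simp only: power2_eq_square mult_ac)
    also have "\<dots> = (qfac q (2 * Suc N))\<^sup>2"
      unfolding Suc unfolding s qfac_Suc unfolding e by (simp only: power2_eq_square mult_ac)
    finally show ?case .
  qed simp
  then have eq: "euler (2 * 1 * c) * ?L N * (qfac (fps_X ^ (2 * c)) N)\<^sup>2 = euler (2 * c) * (qfac (fps_X ^ c) (2 * N))\<^sup>2" for N
    by (simp add: mult.assoc q2 flip: q_def)
  have "(\<lambda>N. euler (2 * 1 * c) * ?L N * (qfac (fps_X ^ (2 * c)) N)\<^sup>2) \<longlonglongrightarrow> theta q 1 0 * (euler (2 * c))\<^sup>2"
    unfolding q_def
    by (intro tendsto_fps_mult tendsto_fps_power triple_product_limit qfac_limit)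
       (use c filterlim_ident in auto)
  moreover have "(\<lambda>N. euler (2 * c) * (qfac (fps_X ^ c) (2 * N))\<^sup>2) \<longlonglongrightarrow> euler (2 * c) * (euler c :: 'a fps)\<^sup>2"
    using c by (intro tendsto_fps_mult tendsto_fps_power tendsto_const qfac_limit filterlim_times_at_top) auto
  ultimately have "theta q 1 0 * (euler (2 * c))\<^sup>2 = euler (2 * c) * (euler c)\<^sup>2"
    unfolding eq by (rule LIMSEQ_unique)
  then have "euler (2 * c) * (theta q 1 0 * euler (2 * c)) = euler (2 * c) * (euler c)\<^sup>2"
    by (simp add: power2_eq_square mult_ac)
  then show ?thesis using c by (simp add: q_def)
qed

text \<open>The exponents 6k + 1 and 6k + 5 are those prime to 6. Inclusion-exclusion removes the
  multiples of 2 and of 3 and restores those of 6, so Omega(-q) = E1 E6^2 / (E2 E3) for c =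
  1.\<close>

lemma theta_3_2:
  assumes c: "c > 0"
  shows "theta (fps_X ^ c) 3 2 * euler (2 * c) * euler (3 * c) = euler c * (euler (6 * c) :: 'a::field fps)\<^sup>2"
proof -
  define q where "q = (fps_X ^ c :: 'a fps)"
  let ?L = "\<lambda>N. \<Prod>k<N. (1 - q ^ (3 * (2 * k + 1) - 2)) * (1 - q ^ (3 * (2 * k + 1) + 2))"
  have qk: "fps_X ^ (k * c) = q ^ k" for k by (simp add: q_def mult.commute flip: power_mult)
  have "?L N * qfac (q\<^sup>2) (3 * N) * qfac (q ^ 3) (2 * N) = qfac q (6 * N) * qfac (q ^ 6) N" for N
  proof (induction N)
    case (Suc N)
    have s: "3 * Suc N = Suc (Suc (Suc (3 * N)))" "2 * Suc N = Suc (Suc (2 * N))"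
      "6 * Suc N = Suc (Suc (Suc (Suc (Suc (Suc (6 * N))))))" by simp_all
    have e: "3 * (2 * N + 1) - 2 = 6 * N + 1" "3 * (2 * N + 1) + 2 = 6 * N + 5"
      "2 * Suc (3 * N) = 6 * N + 2" "2 * Suc (Suc (3 * N)) = 6 * N + 4"
      "2 * Suc (Suc (Suc (3 * N))) = 6 * N + 6" "3 * Suc (2 * N) = 6 * N + 3"
      "3 * Suc (Suc (2 * N)) = 6 * N + 6" "6 * Suc N = 6 * N + 6"
      by simp_all
    have f: "Suc (6 * N) = 6 * N + 1" "Suc (6 * N + 1) = 6 * N + 2" "Suc (6 * N + 2) = 6 * N + 3"
      "Suc (6 * N + 3) = 6 * N + 4" "Suc (6 * N + 4) = 6 * N + 5" "Suc (6 * N + 5) = 6 * N + 6"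
      by simp_all
    let ?f = "\<lambda>i. 1 - q ^ (6 * N + i)"
    have "?L (Suc N) * qfac (q\<^sup>2) (3 * Suc N) * qfac (q ^ 3) (2 * Suc N)
        = (?L N * qfac (q\<^sup>2) (3 * N) * qfac (q ^ 3) (2 * N))
          * (?f 1 * ?f 5 * (?f 2 * ?f 4 * ?f 6) * (?f 3 * ?f 6))"
      unfolding s prod.lessThan_Suc qfac_Suc power_mult [symmetric] e
      by (simp only: mult_ac)
    also have "\<dots> = qfac q (6 * N) * qfac (q ^ 6) N * (?f 1 * ?f 5 * (?f 2 * ?f 4 * ?f 6) * (?f 3 * ?f 6))"
      by (simp only: Suc)
    also have "\<dots> = qfac q (6 * Suc N) * qfac (q ^ 6) (Suc N)"
      unfolding s qfac_Suc power_mult [symmetric] unfolding e f by (simp only: mult_ac)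
    finally show ?case .
  qed simp
  then have eq: "euler (2 * 3 * c) * ?L N * qfac (fps_X ^ (2 * c)) (3 * N) * qfac (fps_X ^ (3 * c)) (2 * N)
      = euler (6 * c) * (qfac (fps_X ^ c) (6 * N) * qfac (fps_X ^ (6 * c)) N)" for N
    unfolding qk by (simp add: mult.assoc flip: q_def)
  have "(\<lambda>N. euler (2 * 3 * c) * ?L N * qfac (fps_X ^ (2 * c)) (3 * N) * qfac (fps_X ^ (3 * c)) (2 * N))
      \<longlonglongrightarrow> theta q 3 2 * euler (2 * c) * euler (3 * c)"
    unfolding q_def
    by (intro tendsto_fps_mult tendsto_fps_power triple_product_limit qfac_limit filterlim_times_at_top)
       (use c in auto)
  moreover have "(\<lambda>N. euler (6 * c) * (qfac (fps_X ^ c) (6 * N) * qfac (fps_X ^ (6 * c)) N))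
      \<longlonglongrightarrow> euler (6 * c) * (euler c * euler (6 * c) :: 'a fps)"
    using c by (intro tendsto_fps_mult tendsto_const qfac_limit filterlim_times_at_top filterlim_ident) auto
  ultimately have "theta q 3 2 * euler (2 * c) * euler (3 * c) = euler (6 * c) * (euler c * euler (6 * c))"
    unfolding eq by (rule LIMSEQ_unique)
  then show ?thesis by (simp add: q_def power2_eq_square mult_ac)
qed

text \<open>For n = 3j + 1 and n = 3j - 1 the exponent is n^2 = 3 (3 j^2 + 2 j) + 1 or 3 (3 j^2 - 2
  j) + 1, with sign -(-1)^j; the two classes have equal sums, hence the factor -2.\<close>

lemma theta_dissection:
  "theta fps_X 1 0 = theta (fps_X ^ 9) 1 0 - 2 * fps_X * theta (fps_X ^ 3 :: 'a::comm_ring_1 fps) 3 2"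
proof -
  define S where "S x m r N = 1 + (\<Sum>j=1..N. (-1) ^ j * (x ^ (m * j\<^sup>2 + r * j) + x ^ (m * j\<^sup>2 - r * j)))"
    for x :: "'a fps" and m r N :: nat
  have eq: "S x 1 0 (3 * N + 1) = S (x ^ 9) 1 0 N + (-2 * x) * S (x ^ 3) 3 2 N" for x N
  proof (induction N)
    case 0
    show ?case by (simp add: S_def)
  next
    case (Suc N)
    have Suc_S: "S x m r (Suc n) = S x m r n
        + (-1) ^ Suc n * (x ^ (m * (Suc n)\<^sup>2 + r * Suc n) + x ^ (m * (Suc n)\<^sup>2 - r * Suc n))"
      for x m r n by (simp add: S_def)
    have s: "3 * Suc N + 1 = Suc (Suc (Suc (3 * N + 1)))" by simp
    have e: "1 * (Suc (3 * N + 1))\<^sup>2 + 0 * Suc (3 * N + 1) = Suc (9 * N\<^sup>2 + 12 * N + 3)"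
      "1 * (Suc (3 * N + 1))\<^sup>2 - 0 * Suc (3 * N + 1) = Suc (9 * N\<^sup>2 + 12 * N + 3)"
      "1 * (Suc (Suc (3 * N + 1)))\<^sup>2 + 0 * Suc (Suc (3 * N + 1)) = 9 * (Suc N)\<^sup>2"
      "1 * (Suc (Suc (3 * N + 1)))\<^sup>2 - 0 * Suc (Suc (3 * N + 1)) = 9 * (Suc N)\<^sup>2"
      "1 * (Suc (Suc (Suc (3 * N + 1))))\<^sup>2 + 0 * Suc (Suc (Suc (3 * N + 1))) = Suc (9 * N\<^sup>2 + 24 * N + 15)"
      "1 * (Suc (Suc (Suc (3 * N + 1))))\<^sup>2 - 0 * Suc (Suc (Suc (3 * N + 1))) = Suc (9 * N\<^sup>2 + 24 * N + 15)"
      "9 * (1 * (Suc N)\<^sup>2 + 0 * Suc N) = 9 * (Suc N)\<^sup>2"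
      "9 * (1 * (Suc N)\<^sup>2 - 0 * Suc N) = 9 * (Suc N)\<^sup>2"
      "3 * (3 * (Suc N)\<^sup>2 - 2 * Suc N) = 9 * N\<^sup>2 + 12 * N + 3"
      "3 * (3 * (Suc N)\<^sup>2 + 2 * Suc N) = 9 * N\<^sup>2 + 24 * N + 15"
      by (simp_all add: power2_eq_square)
    have sgn: "(-1) ^ Suc (3 * N + 1) = ((-1) ^ N :: 'a fps)"
      "(-1) ^ Suc (Suc (3 * N + 1)) = (- ((-1) ^ N) :: 'a fps)"
      "(-1) ^ Suc (Suc (Suc (3 * N + 1))) = ((-1) ^ N :: 'a fps)"
      "(-1) ^ Suc N = (- ((-1) ^ N) :: 'a fps)"
      by (simp_all add: power_add power_mult)
    show ?case
      unfolding s Suc_S Suc power_mult [symmetric] e sgn unfolding power_Suc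
      by (simp only: ring_distribs mult_minus_left mult_minus_right minus_minus mult_2 mult_ac)
         (simp add: add_ac)
  qed
  have S_limit: "S (fps_X ^ c) m r \<longlonglongrightarrow> theta (fps_X ^ c) m r" if "r < m" "c > 0" for c m r
    unfolding S_def using that by (rule theta_partial_sums)
  have "filterlim (\<lambda>N. 3 * N + 1 :: nat) at_top sequentially"
    by (rule filterlim_subseq) (simp add: strict_mono_def)
  then have "(\<lambda>N. S (fps_X ^ 1) 1 0 (3 * N + 1)) \<longlonglongrightarrow> theta (fps_X ^ 1) 1 0"
    by (rule filterlim_compose [OF S_limit, rotated 2]) simp_all
  then have "(\<lambda>N. S (fps_X ^ 9) 1 0 N + (-2 * fps_X) * S (fps_X ^ 3) 3 2 N) \<longlonglongrightarrow> theta (fps_X ^ 1) 1 0"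
    unfolding eq power_mult [symmetric] by simp
  moreover have "(\<lambda>N. S (fps_X ^ 9) 1 0 N + (-2 * fps_X) * S (fps_X ^ 3) 3 2 N)
      \<longlonglongrightarrow> theta (fps_X ^ 9) 1 0 + (-2 * fps_X) * theta (fps_X ^ 3) 3 2"
    by (intro tendsto_fps_add tendsto_fps_mult tendsto_const S_limit) simp_all
  ultimately have "theta (fps_X ^ 1) 1 0 = theta (fps_X ^ 9) 1 0 + (-2 * fps_X) * theta (fps_X ^ 3 :: 'a fps) 3 2"
    by (rule LIMSEQ_unique)
  then show ?thesis by (simp only: power_one_right mult_minus_left add_uminus_conv_diff)
qed

section \<open>The cubic Lambert series\<close>

text \<open>Counterpart of \<open>qratio\<close> among power series, which do not form a field; each
  \<open>1 - fps_X ^ i\<close> is a unit there.\<close>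

definition fps_qratio :: "nat \<Rightarrow> 'a::field fps" where
  "fps_qratio n = (\<Prod>i=1..n. (1 + fps_X ^ i) * inverse (1 - fps_X ^ i))"

lemma fps_to_fls_inverse:
  "fps_nth f 0 \<noteq> 0 \<Longrightarrow> fps_to_fls (inverse f) = inverse (fps_to_fls f :: 'a::field fls)"
  by (simp add: fls_inverse_fps_to_fls subdegree_eq_0_iff)

lemma fps_to_fls_prod: "fps_to_fls (\<Prod>i\<in>A. f i) = (\<Prod>i\<in>A. fps_to_fls (f i :: 'a::comm_ring_1 fps))"
  by (induction A rule: infinite_finite_induct) (auto simp: fls_times_fps_to_fls)

lemma fps_to_fls_sum: "fps_to_fls (\<Sum>i\<in>A. f i) = (\<Sum>i\<in>A. fps_to_fls (f i :: 'a::comm_ring_1 fps))"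
  by (induction A rule: infinite_finite_induct) auto

lemma fps_to_fls_qratio: "fps_to_fls (fps_qratio n :: 'a::field fps) = qratio fls_X n"
  unfolding fps_qratio_def qratio_def fps_to_fls_prod
  by (intro prod.cong refl)
     (simp add: fls_times_fps_to_fls fps_to_fls_inverse fps_to_fls_power divide_inverse)

text \<open>The partial fractions at w = -1 over Laurent series, where the poles exist. Every term
  of the result is a power series, so the identity descends along the injective
  \<open>fps_to_fls\<close>.\<close>

lemma finite_cubic_lambert:
  "(\<Prod>k=1..N. (1 - fps_X ^ k + fps_X ^ (2 * k)) * inverse (1 + fps_X ^ k + fps_X ^ (2 * k)))
    = (fps_qratio N :: 'a::field fps)\<^sup>2 + 2 * (\<Sum>k=1..N. (-1) ^ k * fps_qratio (N - k) * fps_qratio (N + k)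
        * (3 * fps_X ^ k * inverse (1 + fps_X ^ k + fps_X ^ (2 * k))))"
    (is "?L = ?R")
proof -
  let ?q = "fls_X :: 'a fls"
  have q: "?q ^ i \<noteq> 1" if "i > 0" for i
  proof
    assume "?q ^ i = 1"
    then have "fps_to_fls (fps_X ^ i :: 'a fps) = fps_to_fls 1" by (simp add: fps_to_fls_power)
    then have "fps_nth (fps_X ^ i :: 'a fps) 0 = 1" by (simp only: fps_to_fls_eq_iff) simp
    then show False using that by simp
  qed
  have conv: "1 + ?q ^ k + ?q ^ (2 * k) = fps_to_fls (1 + fps_X ^ k + fps_X ^ (2 * k))" for k
    by (simp add: fps_to_fls_power)
  have nth: "fps_nth (1 + fps_X ^ k + fps_X ^ (2 * k) :: 'a fps) 0 = 1" if "k \<in> {1..N}" for k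
    using that by simp
  then have inv: "fps_to_fls (inverse (1 + fps_X ^ k + fps_X ^ (2 * k) :: 'a fps)) = inverse (1 + ?q ^ k + ?q ^ (2 * k))"
    if "k \<in> {1..N}" for k
    unfolding conv using that by (intro fps_to_fls_inverse) simp
  have "1 - (-1) * ?q ^ k + ?q ^ (2 * k) \<noteq> 0" if "k \<in> {1..N}" for k
  proof
    assume "1 - (-1) * ?q ^ k + ?q ^ (2 * k) = 0"
    then have "1 + fps_X ^ k + fps_X ^ (2 * k) = (0 :: 'a fps)"
      using conv [of k] by (simp del: fps_to_fls_plus)
    from nth [OF that, unfolded this] show False by simp
  qed
  with q have "(\<Prod>k=1..N. (1 + (-1) * ?q ^ k + ?q ^ (2 * k)) / (1 - (-1) * ?q ^ k + ?q ^ (2 * k)))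
    = (qratio ?q N)\<^sup>2 + 2 * (\<Sum>k=1..N. (-1) ^ k * qratio ?q (N - k) * qratio ?q (N + k)
        * ((2 - (-1)) * ?q ^ k / (1 - (-1) * ?q ^ k + ?q ^ (2 * k))))"
    by (intro finite_partial_fractions) auto
  also have "(\<Prod>k=1..N. (1 + (-1) * ?q ^ k + ?q ^ (2 * k)) / (1 - (-1) * ?q ^ k + ?q ^ (2 * k))) = fps_to_fls ?L"
    unfolding fps_to_fls_prod
  proof (intro prod.cong refl)
    fix k assume "k \<in> {1..N}"
    from inv [OF this]
    show "(1 + (-1) * ?q ^ k + ?q ^ (2 * k)) / (1 - (-1) * ?q ^ k + ?q ^ (2 * k))
      = fps_to_fls ((1 - fps_X ^ k + fps_X ^ (2 * k)) * inverse (1 + fps_X ^ k + fps_X ^ (2 * k)))"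
      by (simp add: fls_times_fps_to_fls fps_to_fls_power divide_inverse)
  qed
  also have "(\<Sum>k=1..N. (-1) ^ k * qratio ?q (N - k) * qratio ?q (N + k)
        * ((2 - (-1)) * ?q ^ k / (1 - (-1) * ?q ^ k + ?q ^ (2 * k))))
    = (\<Sum>k=1..N. fps_to_fls ((-1) ^ k * fps_qratio (N - k) * fps_qratio (N + k)
        * (3 * fps_X ^ k * inverse (1 + fps_X ^ k + fps_X ^ (2 * k)))))"
  proof (intro sum.cong refl)
    fix k assume "k \<in> {1..N}"
    from inv [OF this]
    show "(-1) ^ k * qratio ?q (N - k) * qratio ?q (N + k)
        * ((2 - (-1)) * ?q ^ k / (1 - (-1) * ?q ^ k + ?q ^ (2 * k)))
      = fps_to_fls ((-1) ^ k * fps_qratio (N - k) * fps_qratio (N + k)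
        * (3 * fps_X ^ k * inverse (1 + fps_X ^ k + fps_X ^ (2 * k))))"
      by (simp add: fls_times_fps_to_fls fps_to_fls_power fps_to_fls_qratio divide_inverse)
  qed
  also have "(qratio ?q N)\<^sup>2 + 2 * (\<Sum>k=1..N. fps_to_fls ((-1) ^ k * fps_qratio (N - k) * fps_qratio (N + k)
        * (3 * fps_X ^ k * inverse (1 + fps_X ^ k + fps_X ^ (2 * k))))) = fps_to_fls ?R"
    by (simp add: fls_times_fps_to_fls fps_to_fls_power fps_to_fls_qratio fps_to_fls_sum)
  finally show ?thesis by (simp only: fps_to_fls_eq_iff)
qed

lemma fps_qratio_qfac:
  "fps_qratio n * (qfac fps_X n)\<^sup>2 = (qfac (fps_X\<^sup>2) n :: 'a::field fps)"
proof (induction n)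
  case (Suc n)
  let ?x = "fps_X ^ Suc n :: 'a fps"
  have i: "inverse (1 - ?x) * (1 - ?x) = 1"
    by (rule inverse_mult_eq_1) simp
  have "fps_qratio (Suc n) * (qfac fps_X (Suc n))\<^sup>2
      = (fps_qratio n * (qfac fps_X n)\<^sup>2) * ((1 + ?x) * (1 - ?x)) * (inverse (1 - ?x) * (1 - ?x))"
    unfolding qfac_Suc power_mult_distrib by (simp add: fps_qratio_def power2_eq_square mult_ac del: power_Suc)
  also have "\<dots> = qfac (fps_X\<^sup>2) n * ((1 + ?x) * (1 - ?x))"
    unfolding i Suc by simp
  also have "(1 + ?x) * (1 - ?x) = 1 - (fps_X\<^sup>2) ^ Suc n"
  proof -
    have "(1 + y) * (1 - y) = 1 - y\<^sup>2" for y :: "'a fps"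
      by (simp add: algebra_simps power2_eq_square)
    moreover have "(fps_X\<^sup>2) ^ Suc n = ?x\<^sup>2" by (metis mult.commute power_mult)
    ultimately show ?thesis by (simp only:)
  qed
  finally show ?case by (simp only: qfac_Suc)
qed (simp add: fps_qratio_def)

lemma fps_qratio_limit:
  assumes "filterlim h at_top F"
  shows "((\<lambda>x. fps_qratio (h x)) \<longlongrightarrow> euler 2 * inverse ((euler 1)\<^sup>2 :: 'a::field fps)) F"
proof -
  have "((\<lambda>x. qfac (fps_X ^ 2) (h x) * inverse ((qfac (fps_X ^ 1) (h x))\<^sup>2)) \<longlongrightarrow> euler 2 * inverse ((euler 1)\<^sup>2 :: 'a fps)) F"
    by (intro tendsto_fps_mult tendsto_inverse_fps tendsto_fps_power qfac_limit assms) (simp_all add: fps_power_zeroth)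
  moreover have "qfac (fps_X ^ 2) n * inverse ((qfac (fps_X ^ 1) n)\<^sup>2) = (fps_qratio n :: 'a fps)" for n
  proof -
    have "(qfac fps_X n)\<^sup>2 * inverse ((qfac fps_X n)\<^sup>2) = (1 :: 'a fps)"
      using qfac_nth_0 [of 1 n, where 'a = 'a] by (intro inverse_mult_eq_1') (simp add: fps_power_zeroth)
    then show ?thesis
      unfolding power_one_right fps_qratio_qfac [symmetric] mult.assoc by (simp only: mult_1_right)
  qed
  ultimately show ?thesis by simp
qed

text \<open>The limit of \<open>finite_cubic_lambert\<close> divided by the square of the limit of
  \<open>fps_qratio\<close>. In the overview's terms the bracket equals phi(-q)^3 / phi(-q^3),
  written without division.\<close>

lemma cubic_lambert_series:
  "(1 + 2 * fps_infsum1 (\<lambda>k. (-1) ^ k * (3 * fps_X ^ k * inverse (1 + fps_X ^ k + fps_X ^ (2 * k)))))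
     * (euler 3)\<^sup>2 * (euler 2) ^ 3 = (euler 1 :: 'a::field fps) ^ 6 * euler 6"
    (is "(1 + 2 * fps_infsum1 ?t) * _ * _ = _")
proof -
  define P where "P = euler 2 * inverse ((euler 1)\<^sup>2 :: 'a fps)"
  define L where "L N = (\<Prod>k=1..N. (1 - fps_X ^ k + fps_X ^ (2 * k)) * inverse (1 + fps_X ^ k + fps_X ^ (2 * k)) :: 'a fps)" for N
  have P0: "fps_nth P 0 \<noteq> 0" by (simp add: P_def fps_power_zeroth)
  have PE: "P * (euler 1)\<^sup>2 = euler 2"
    unfolding P_def mult.assoc by (subst inverse_mult_eq_1) (simp_all add: fps_power_zeroth)
  \<comment> \<open>Multiplying by \<open>K\<close>, the inverse square of \<open>P\<close>, makes
    the constant term and the coefficients in front of \<open>?t k\<close> tend to 1.\<close>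
  define K where "K = inverse P * inverse P"
  have KP: "K * P * P = 1"
  proof -
    have "K * P * P = (inverse P * P) * (inverse P * P)" unfolding K_def by (simp only: mult_ac)
    then show ?thesis by (simp only: inverse_mult_eq_1 [OF P0] mult_1)
  qed
  have lim_P: "((\<lambda>x. fps_qratio (h x)) \<longlongrightarrow> P) F" if "filterlim h at_top F" for h :: "nat \<Rightarrow> nat" and F
    unfolding P_def by (rule fps_qratio_limit [OF that])
  have sub: "filterlim (\<lambda>N. N - j) at_top sequentially" for j :: nat
    by (rule filterlim_minus_const_nat_at_top)
  have add: "filterlim (\<lambda>N. N + j) at_top sequentially" for j :: nat
    by (rule filterlim_subseq) (simp add: strict_mono_def)
  have "K * L N = K * fps_qratio N * fps_qratio N
      + 2 * (\<Sum>k=1..N. K * fps_qratio (N - k) * fps_qratio (N + k) * ?t k)" for N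
    unfolding L_def finite_cubic_lambert
    by (simp add: distrib_left sum_distrib_left power2_eq_square mult_ac)
  moreover have "(\<lambda>N. K * fps_qratio N * fps_qratio N
      + 2 * (\<Sum>k=1..N. K * fps_qratio (N - k) * fps_qratio (N + k) * ?t k))
      \<longlonglongrightarrow> K * P * P + 2 * fps_infsum1 (\<lambda>k. K * P * P * ?t k)"
    by (intro tendsto_fps_add tendsto_fps_mult tendsto_const tendsto_fps_infsum1 lim_P sub add filterlim_ident
        dvd_mult dvd_mult2 dvd_refl)
  ultimately have lim_L: "(\<lambda>N. K * L N) \<longlonglongrightarrow> 1 + 2 * fps_infsum1 ?t"
    by (simp add: KP)
  \<comment> \<open>From 1 + y + y^2 = (1 - y^3) / (1 - y) and 1 - y + y^2 = (1 - y^6) (1 - y) / ((1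
    - y^3) (1 - y^2)) with y = q^k.\<close>
  have L: "L N * (qfac (fps_X ^ 3) N)\<^sup>2 * qfac (fps_X ^ 2) N = qfac (fps_X ^ 6) N * (qfac (fps_X ^ 1) N)\<^sup>2" for N
  proof (induction N)
    case (Suc N)
    have id1: "(1 - y ^ 3)\<^sup>2 = (1 + y + y\<^sup>2) * ((1 - y) * (1 - y ^ 3))"
      and id2: "(1 - y + y\<^sup>2) * (1 - y) * (1 - y ^ 3) * (1 - y\<^sup>2) = (1 - y ^ 6) * (1 - y ^ 1)\<^sup>2" for y :: "'a fps"
      by (simp_all add: algebra_simps eval_nat_numeral)
    let ?x = "fps_X ^ Suc N :: 'a fps"
    have i: "inverse (1 + ?x + ?x\<^sup>2) * (1 + ?x + ?x\<^sup>2) = 1"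
      by (rule inverse_mult_eq_1) (simp add: fps_power_zeroth)
    have x: "fps_X ^ (m * Suc N) = ?x ^ m" for m
      by (metis mult.commute power_mult)
    have "L (Suc N) * (qfac (fps_X ^ 3) (Suc N))\<^sup>2 * qfac (fps_X ^ 2) (Suc N)
        = (L N * (qfac (fps_X ^ 3) N)\<^sup>2 * qfac (fps_X ^ 2) N)
          * ((1 - ?x + ?x\<^sup>2) * inverse (1 + ?x + ?x\<^sup>2) * (1 - ?x ^ 3)\<^sup>2 * (1 - ?x\<^sup>2))"
      unfolding qfac_Suc power_mult [symmetric] x L_def by (simp add: x power_mult_distrib mult_ac del: power_Suc)
    also have "(1 - ?x ^ 3)\<^sup>2 = (1 + ?x + ?x\<^sup>2) * ((1 - ?x) * (1 - ?x ^ 3))"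
      by (rule id1)
    also have "(1 - ?x + ?x\<^sup>2) * inverse (1 + ?x + ?x\<^sup>2) * ((1 + ?x + ?x\<^sup>2) * ((1 - ?x) * (1 - ?x ^ 3))) * (1 - ?x\<^sup>2)
        = (inverse (1 + ?x + ?x\<^sup>2) * (1 + ?x + ?x\<^sup>2)) * ((1 - ?x + ?x\<^sup>2) * (1 - ?x) * (1 - ?x ^ 3) * (1 - ?x\<^sup>2))"
      by (simp only: mult_ac)
    also have "\<dots> = (1 - ?x ^ 6) * (1 - ?x ^ 1)\<^sup>2"
      unfolding i mult_1 by (rule id2)
    also have "(L N * (qfac (fps_X ^ 3) N)\<^sup>2 * qfac (fps_X ^ 2) N) * ((1 - ?x ^ 6) * (1 - ?x ^ 1)\<^sup>2)
        = qfac (fps_X ^ 6) (Suc N) * (qfac (fps_X ^ 1) (Suc N))\<^sup>2"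
      unfolding Suc qfac_Suc power_mult [symmetric] x by (simp only: power_mult_distrib mult_ac)
    finally show ?case .
  qed (simp add: L_def)
  have "(\<lambda>N. K * L N * (qfac (fps_X ^ 3) N)\<^sup>2 * qfac (fps_X ^ 2) N) \<longlonglongrightarrow> (1 + 2 * fps_infsum1 ?t) * (euler 3)\<^sup>2 * euler 2"
    by (intro tendsto_fps_mult lim_L tendsto_fps_power qfac_limit filterlim_ident) auto
  moreover have "(\<lambda>N. K * (qfac (fps_X ^ 6) N * (qfac (fps_X ^ 1) N)\<^sup>2)) \<longlonglongrightarrow> K * (euler 6 * (euler 1)\<^sup>2)"
    by (intro tendsto_fps_mult tendsto_const tendsto_fps_power qfac_limit filterlim_ident) auto
  ultimately have "(1 + 2 * fps_infsum1 ?t) * (euler 3)\<^sup>2 * euler 2 = K * (euler 6 * (euler 1)\<^sup>2)"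
    unfolding mult.assoc [of K] L by (rule LIMSEQ_unique)
  \<comment> \<open>Two further factors c are written as P a^2, so that \<open>K\<close> cancels and
    only Euler products remain.\<close>
  moreover have "s * d\<^sup>2 * c ^ 3 = a ^ 6 * e"
    if "s * d\<^sup>2 * c = K * (e * a\<^sup>2)" "P * a\<^sup>2 = c" for s a c d e :: "'a fps"
  proof -
    have "s * d\<^sup>2 * c ^ 3 = (s * d\<^sup>2 * c) * c\<^sup>2"
      by (simp add: eval_nat_numeral mult_ac)
    also have "\<dots> = (K * (e * a\<^sup>2)) * (P * a\<^sup>2)\<^sup>2"
      by (simp only: that)
    also have "\<dots> = (K * P * P) * (a ^ 6 * e)"
      by (simp add: eval_nat_numeral mult_ac)
    finally show ?thesis by (simp only: KP mult_1)
  qed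
  ultimately show ?thesis using PE by blast
qed

lemma fps_infsum1_cong:
  "(\<And>n. n > 0 \<Longrightarrow> f n = g n) \<Longrightarrow> fps_infsum1 f = fps_infsum1 g"
  by (simp add: fps_infsum1_def)

lemma fps_divide_mult_unit: "fps_nth g 0 \<noteq> 0 \<Longrightarrow> f / g * g = (f :: 'a::field fps)"
  by (simp add: fps_divide_unit mult.assoc inverse_mult_eq_1)

lemma euler_minus: "qpoch_inf (- fps_X) fps_X * euler 1 = (euler 2 :: 'a::field fps)"
proof -
  have "(\<lambda>N. (\<Prod>k<N. 1 - (- fps_X) * fps_X ^ k) * qfac (fps_X ^ 1) N) \<longlonglongrightarrow> qpoch_inf (- fps_X) fps_X * (euler 1 :: 'a fps)"
    by (intro tendsto_fps_mult qpoch_inf_limit qfac_limit filterlim_ident) auto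
  moreover have "(\<Prod>k<N. 1 - (- fps_X) * fps_X ^ k) * qfac (fps_X ^ 1) N = (qfac (fps_X ^ 2) N :: 'a fps)" for N
  proof (induction N)
    case (Suc N)
    have "(1 - (- y)) * (1 - y) = 1 - y\<^sup>2" for y :: "'a fps"
      by (simp add: algebra_simps power2_eq_square)
    from this [of "fps_X ^ Suc N"]
    have *: "(1 - (- fps_X) * fps_X ^ N) * (1 - (fps_X ^ 1) ^ Suc N) = 1 - (fps_X\<^sup>2 :: 'a fps) ^ Suc N"
      unfolding power_mult [symmetric] by (simp only: power_Suc mult_minus_left mult.commute [of 2] mult_1)
    show ?case
      unfolding prod.lessThan_Suc qfac_Suc Suc [symmetric] * [symmetric] by (simp only: mult_ac)
  qed simp
  moreover have "(\<lambda>N. qfac (fps_X ^ 2) N) \<longlonglongrightarrow> (euler 2 :: 'a fps)"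
    by (intro qfac_limit filterlim_ident) simp
  ultimately show ?thesis
    using LIMSEQ_unique by simp
qed

section \<open>The dissection\<close>

text \<open>Pure algebra in an integral domain: each quotient enters through its defining product
  relation, so no division of power series occurs. Here x is q, v the left-hand side, b twice the
  bracket, t = phi(-q), t' = phi(-q^9) and r = Omega(-q^3).\<close>

lemma combine_dissection:
  fixes v x :: "'a::idom"
  assumes nz: "E1 \<noteq> 0" "E2 \<noteq> 0" "E3 \<noteq> 0" "E6 \<noteq> 0" "E9 \<noteq> 0" "E18 \<noteq> 0" "(2 :: 'a) \<noteq> 0"
    and v: "2 * v * E1\<^sup>2 = E2 * b"
    and b: "b * E3\<^sup>2 * E2 ^ 3 = E1 ^ 6 * E6"
    and t: "t * E2 = E1\<^sup>2" "t' * E18 = E9\<^sup>2" "r * E6 * E9 = E3 * E18\<^sup>2" "t = t' - 2 * x * r"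
    and a: "a0 * (2 * E3\<^sup>2 * E18\<^sup>2) = E9 ^ 4 * E6" "a1 * E3 = - 2 * (E18 * E9)"
      "a2 * (E9\<^sup>2 * E6) = 2 * E18 ^ 4"
  shows "v = a0 + x * a1 + x\<^sup>2 * a2"
proof -
  have "(E1\<^sup>2 * E2\<^sup>2) * (v * (2 * E3\<^sup>2)) = (2 * v * E1\<^sup>2) * E3\<^sup>2 * E2\<^sup>2"
    by (simp only: mult_ac)
  also have "\<dots> = b * E3\<^sup>2 * E2 ^ 3"
    unfolding v by (simp add: eval_nat_numeral mult_ac)
  also have "\<dots> = E1\<^sup>2 * (t * E2)\<^sup>2 * E6"
    unfolding b t(1) by (simp add: eval_nat_numeral mult_ac)
  also have "\<dots> = (E1\<^sup>2 * E2\<^sup>2) * (t\<^sup>2 * E6)"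
    by (simp add: power_mult_distrib mult_ac)
  finally have "v * (2 * E3\<^sup>2) = t\<^sup>2 * E6"
    using nz by simp
  \<comment> \<open>So far v = phi(-q)^2 / (2 phi(-q^3)), where phi(-q^3) = E3^2 / E6. The three
    terms of the expanded square are now matched with a0, a1 and a2 one by one.\<close>
  also have "t\<^sup>2 * E6 = t'\<^sup>2 * E6 + x * (- 4 * t' * r * E6) + x\<^sup>2 * (4 * r\<^sup>2 * E6)"
    unfolding t(4) by (simp add: algebra_simps power2_eq_square)
  also have "t'\<^sup>2 * E6 = a0 * (2 * E3\<^sup>2)"
  proof -
    have "E18\<^sup>2 * (t'\<^sup>2 * E6) = (t' * E18)\<^sup>2 * E6" by (simp add: power_mult_distrib mult_ac)
    also have "\<dots> = E18\<^sup>2 * (a0 * (2 * E3\<^sup>2))"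
      unfolding t(2) using a(1) by (simp add: mult_ac flip: power_mult)
    finally show ?thesis using nz by simp
  qed
  also have "- 4 * t' * r * E6 = a1 * (2 * E3\<^sup>2)"
  proof -
    have "(E18 * E9) * (- 4 * t' * r * E6) = - 4 * ((t' * E18) * (r * E6 * E9))" by (simp add: mult_ac)
    also have "\<dots> = (E18 * E9) * ((- 2 * (E18 * E9)) * 2 * E3)"
      unfolding t(2,3) by (simp add: power2_eq_square mult_ac)
    also have "\<dots> = (E18 * E9) * (a1 * (2 * E3\<^sup>2))"
      unfolding a(2) [symmetric] by (simp add: power2_eq_square mult_ac)
    finally have "(E18 * E9) * (- 4 * t' * r * E6) = (E18 * E9) * (a1 * (2 * E3\<^sup>2))" .
    moreover have "E18 * E9 \<noteq> 0" using nz by simp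
    ultimately show ?thesis using mult_left_cancel by blast
  qed
  also have "4 * r\<^sup>2 * E6 = a2 * (2 * E3\<^sup>2)"
  proof -
    have "(E9\<^sup>2 * E6) * (4 * r\<^sup>2 * E6) = 4 * (r * E6 * E9)\<^sup>2" by (simp add: power2_eq_square mult_ac)
    also have "\<dots> = (2 * E18 ^ 4) * (2 * E3\<^sup>2)"
      unfolding t(3) by (simp add: eval_nat_numeral mult_ac)
    also have "\<dots> = (E9\<^sup>2 * E6) * (a2 * (2 * E3\<^sup>2))"
      unfolding a(3) [symmetric] by (simp only: mult_ac)
    finally have "(E9\<^sup>2 * E6) * (4 * r\<^sup>2 * E6) = (E9\<^sup>2 * E6) * (a2 * (2 * E3\<^sup>2))" .
    moreover have "E9\<^sup>2 * E6 \<noteq> 0" using nz by simp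
    ultimately show ?thesis using mult_left_cancel by blast
  qed
  finally have "v * (2 * E3\<^sup>2) = (a0 + x * a1 + x\<^sup>2 * a2) * (2 * E3\<^sup>2)"
    by (simp only: distrib_right mult.assoc)
  then show ?thesis using nz by (simp add: mult_right_cancel)
qed

text \<open>All rests on z + 1/z = -1: the constant is 2 - (z + 1/z) = 3, and the denominator is 1 -
  (z + 1/z) y + y^2 with y = q^n.\<close>

lemma cube_root_summand:
  fixes z :: complex
  assumes z: "z ^ 3 = 1" "z \<noteq> 1" and n: "n > 0"
  shows "fps_const ((1 - z) * (1 - inverse z) * (-1) ^ n) * fps_X ^ n /
         ((1 - fps_const z * fps_X ^ n) * (1 - fps_const (inverse z) * fps_X ^ n))
    = (-1) ^ n * (3 * fps_X ^ n * inverse (1 + fps_X ^ n + fps_X ^ (2 * n)))"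
proof -
  have z0: "z \<noteq> 0" using z(1) by auto
  have "(z - 1) * (z\<^sup>2 + z + 1) = 0"
    using z(1) by (simp add: algebra_simps eval_nat_numeral)
  then have "z\<^sup>2 + z + 1 = 0" using z(2) by simp
  then have "z * (z + inverse z) = z * (-1)"
    using z0 by (simp add: distrib_left power2_eq_square eq_neg_iff_add_eq_0 add_ac)
  then have sum: "z + inverse z = -1" using z0 mult_left_cancel by blast
  have c: "(1 - z) * (1 - inverse z) = 3"
  proof -
    have "(1 - z) * (1 - inverse z) = 2 - (z + inverse z)" using z0 by (simp add: algebra_simps)
    then show ?thesis unfolding sum by simp
  qed
  have den: "(1 - fps_const z * fps_X ^ n) * (1 - fps_const (inverse z) * fps_X ^ n)
      = 1 + fps_X ^ n + fps_X ^ (2 * n)"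
  proof -
    have "(1 - c * y) * (1 - d * y) = 1 - (c + d) * y + (c * d) * y\<^sup>2" for c d y :: "complex fps"
      by (simp add: algebra_simps power2_eq_square)
    then have "(1 - fps_const z * fps_X ^ n) * (1 - fps_const (inverse z) * fps_X ^ n)
      = 1 - fps_const (z + inverse z) * fps_X ^ n + fps_const (z * inverse z) * (fps_X ^ n)\<^sup>2"
      by (simp only: fps_const_add fps_const_mult)
    also have "\<dots> = 1 + fps_X ^ n + (fps_X ^ n)\<^sup>2"
      unfolding sum using z0 by (simp flip: fps_const_neg)
    finally show ?thesis by (simp only: power_even_eq)
  qed
  have "fps_const (-1) = (-1 :: complex fps)"
    by (simp only: fps_const_neg [symmetric] fps_const_1_eq_1)
  then have "fps_const (3 * (-1) ^ n) = (3 * (-1) ^ n :: complex fps)"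
    by (simp only: numeral_fps_const fps_const_mult [symmetric] fps_const_power [symmetric])
  then show ?thesis
    unfolding den c using n by (subst fps_divide_unit) (simp_all only: mult_ac, simp)
qed

theorem theorem2p13:
  fixes z :: complex
  assumes "z ^ 3 = 1" and "z \<noteq> 1"
  shows "qpoch_inf (- fps_X) fps_X / qpoch_inf fps_X fps_X *
      (fps_const (1/2) + fps_infsum1 (\<lambda>n.
         fps_const ((1 - z) * (1 - inverse z) * (-1) ^ n) * fps_X ^ n /
         ((1 - fps_const z * fps_X ^ n) * (1 - fps_const (inverse z) * fps_X ^ n))))
    = A0 (fps_X ^ 3) + fps_X * A1 (fps_X ^ 3) + fps_X ^ 2 * A2 (fps_X ^ 3)"
    (is "?D / _ * ?B = _")
proof (rule combine_dissection)
  let ?e = "euler :: nat \<Rightarrow> complex fps"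
  define b :: "complex fps" where
    "b = 1 + 2 * fps_infsum1 (\<lambda>k. (-1) ^ k * (3 * fps_X ^ k * inverse (1 + fps_X ^ k + fps_X ^ (2 * k))))"
  have E: "qpoch_inf ((fps_X ^ 3) ^ k) ((fps_X ^ 3) ^ k) = ?e (3 * k)" for k
    by (simp add: euler_def flip: power_mult)
  have E': "qpoch_inf (fps_X ^ 3) (fps_X ^ 3) = ?e 3" "qpoch_inf fps_X fps_X = ?e 1"
    by (simp_all add: euler_def)
  have half: "2 * fps_const (1 / 2) = (1 :: complex fps)"
    by (simp only: numeral_fps_const fps_const_mult) simp
  have B: "2 * ?B = b"
    unfolding distrib_left half b_def
    by (intro arg_cong2 [where f = "(+)"] arg_cong2 [where f = "(*)"] fps_infsum1_cong refl cube_root_summand assms)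
  \<comment> \<open>One factor \<open>?e 1\<close> clears the denominator (q;q); the other turns
    (-q;q) into \<open>?e 2\<close> by \<open>euler_minus\<close>.\<close>
  show "2 * (?D / qpoch_inf fps_X fps_X * ?B) * (?e 1)\<^sup>2 = ?e 2 * b"
  proof -
    have "2 * (?D / ?e 1 * ?B) * (?e 1)\<^sup>2 = (?D / ?e 1 * ?e 1) * ?e 1 * (2 * ?B)"
      by (simp only: power2_eq_square mult_ac)
    also have "?D / ?e 1 * ?e 1 = ?D"
      by (rule fps_divide_mult_unit) simp
    also have "?D * ?e 1 * (2 * ?B) = ?e 2 * b"
      by (simp only: B euler_minus)
    finally show ?thesis unfolding E' .
  qed
  show "b * (?e 3)\<^sup>2 * ?e 2 ^ 3 = ?e 1 ^ 6 * ?e 6"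
    unfolding b_def by (rule cubic_lambert_series)
  show "theta fps_X 1 0 * ?e 2 = (?e 1)\<^sup>2"
    using theta_1_0 [of 1, where 'a = complex] by simp
  show "theta (fps_X ^ 9) 1 0 * ?e 18 = (?e 9)\<^sup>2"
    using theta_1_0 [of 9, where 'a = complex] by simp
  show "theta (fps_X ^ 3) 3 2 * ?e 6 * ?e 9 = ?e 3 * (?e 18)\<^sup>2"
    using theta_3_2 [of 3, where 'a = complex] by simp
  show "theta fps_X 1 0 = theta (fps_X ^ 9) 1 0 - 2 * fps_X * theta (fps_X ^ 3 :: complex fps) 3 2"
    by (rule theta_dissection)
  show "A0 (fps_X ^ 3) * (2 * (?e 3)\<^sup>2 * (?e 18)\<^sup>2) = ?e 9 ^ 4 * ?e 6"
    unfolding A0_def E E' arith_simps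
    by (rule fps_divide_mult_unit) (simp add: fps_power_zeroth)
  show "A1 (fps_X ^ 3) * ?e 3 = - 2 * (?e 18 * ?e 9)"
    unfolding A1_def E E' arith_simps by (rule fps_divide_mult_unit) simp
  show "A2 (fps_X ^ 3) * ((?e 9)\<^sup>2 * ?e 6) = 2 * ?e 18 ^ 4"
    unfolding A2_def E E' arith_simps by (rule fps_divide_mult_unit) (simp add: fps_power_zeroth)
qed simp_all

end
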